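(* Let $\sigma_0>0$, $S_0>0$, and let $V(T)=\mathbb{E}[(S_T-S_0)^+]$, $T>0$, be the at-the-money option time value in the uncorrelated log-normal ($\beta=1$) SABR model with $\omega=1$. Then the short-maturity expansion of $V$ is asymptotic and non-convergent: as $T\to0^+$, $V(T)/\sqrt{T}$ has an asymptotic expansion in powers of $T$, $V(T)/\sqrt{T}\sim\sum_{k=0}^\infty v_kT^k$, and the power series $\sum_{k\ge0}v_kT^k$ has zero radius of convergence.
   Context: The uncorrelated log-normal SABR model with $\omega=1$: $dS_t=\sigma_t S_t\,dW_t$, $d\sigma_t=\sigma_t\,dZ_t$, with $W,Z$ independent standard Brownian motions and deterministic initial values $S_0>0$, $\sigma_0>0$. At strike $K=S_0$ the option time value has the exact representation (known, taken as the starting point) $$V(T)=\frac{2S_0e^{-T/8}}{\pi^{3/2}\sqrt{T}}\int_0^\infty e^{-\frac{u^2}{2T}}g(u)\,du,\qquad g(u)=\sinh u\int_0^u\frac{h(s)}{\sqrt{\cosh u-\cosh s}}\,ds\quad(u>0),$$ $$h(s)=\frac{\sin(\frac{\sigma_0}{2}\sinh s)}{\sinh s},\quad h(0)=\frac{\sigma_0}{2}.$$ The notation $f(T)\sim\sum_k c_kT^k$ as $T\to0^+$ means that for every $N$, $f(T)-\sum_{k=0}^N c_kT^k=O(T^{N+1})$. *)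

theory Defs
  imports "HOL-Probability.Probability"
begin

definition conv_in_prob ::
    "'a measure \<Rightarrow> (nat \<Rightarrow> 'a \<Rightarrow> real) \<Rightarrow> ('a \<Rightarrow> real) \<Rightarrow> bool" where
  "conv_in_prob M X Y \<longleftrightarrow>
     (\<forall>e>0. (\<lambda>n. measure M {x \<in> space M. \<bar>X n x - Y x\<bar> > e}) \<longlonglongrightarrow> 0)"

definition continuous_adapted ::
    "'a measure \<Rightarrow> (real \<Rightarrow> 'a measure) \<Rightarrow> (real \<Rightarrow> 'a \<Rightarrow> real) \<Rightarrow> bool" where
  "continuous_adapted M F X \<longleftrightarrow>
     (\<forall>t\<ge>0. X t \<in> borel_measurable (F t)) \<and>
     (AE x in M. continuous_on {0..} (\<lambda>t. X t x))"

definition standard_brownian_motion ::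
    "'a measure \<Rightarrow> (real \<Rightarrow> 'a measure) \<Rightarrow> (real \<Rightarrow> 'a \<Rightarrow> real) \<Rightarrow> bool" where
  "standard_brownian_motion M F W \<longleftrightarrow>
     continuous_adapted M F W \<and>
     (AE x in M. W 0 x = 0) \<and>
     (\<forall>s t. 0 \<le> s \<and> s < t \<longrightarrow>
        distributed M lborel (\<lambda>x. W t x - W s x) (normal_density 0 (sqrt (t - s))) \<and>
        prob_space.indep_set M (sets (F s))
          (sets (vimage_algebra (space M) (\<lambda>x. W t x - W s x) borel)))"

definition independent_processes ::
    "'a measure \<Rightarrow> (real \<Rightarrow> 'a \<Rightarrow> real) \<Rightarrow> (real \<Rightarrow> 'a \<Rightarrow> real) \<Rightarrow> bool" where
  "independent_processes M X Y \<longleftrightarrow>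
     prob_space.indep_var M
       (\<Pi>\<^sub>M t\<in>{0..}. borel) (\<lambda>x. \<lambda>t\<in>{0..}. X t x)
       (\<Pi>\<^sub>M t\<in>{0..}. borel) (\<lambda>x. \<lambda>t\<in>{0..}. Y t x)"

text \<open>
  For an integrand \<open>H\<close> that is adapted with continuous paths, the Ito integral
  \<open>I t\<close> of \<open>H\<close> against the Brownian motion \<open>W\<close> over \<open>[0, t]\<close> is the limit in probability
  of the left-endpoint Riemann sums. The limit does not depend on the partitions as long
  as their mesh tends to 0, so uniform partitions are used. The definition is meant
  for such integrands only.
\<close>

definition has_ito_integral ::
    "'a measure \<Rightarrow> (real \<Rightarrow> 'a \<Rightarrow> real) \<Rightarrow> (real \<Rightarrow> 'a \<Rightarrow> real) \<Rightarrow> (real \<Rightarrow> 'a \<Rightarrow> real) \<Rightarrow> bool" where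
  "has_ito_integral M W H I \<longleftrightarrow>
     (\<forall>t\<ge>0. conv_in_prob M
        (\<lambda>n x. \<Sum>i<n. H (t * real i / real n) x *
                 (W (t * real (Suc i) / real n) x - W (t * real i / real n) x))
        (I t))"

text \<open>
  The uncorrelated SABR model with \<open>\<beta> = 1\<close> and \<open>\<omega> = 1\<close>, that is
  \<open>dS = \<sigma> S dW\<close>, \<open>d\<sigma> = \<sigma> dZ\<close>, in integral form.
\<close>

locale sabr_model = prob_space M + filtration "space M" F
  for M :: "'a measure" and F :: "real \<Rightarrow> 'a measure" +
  fixes W Z S \<sigma> :: "real \<Rightarrow> 'a \<Rightarrow> real"
    and S\<^sub>0 \<sigma>\<^sub>0 :: real
  assumes sets_F_subset: "\<And>t. sets (F t) \<subseteq> sets M"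
    and S\<^sub>0_pos: "S\<^sub>0 > 0"
    and \<sigma>\<^sub>0_pos: "\<sigma>\<^sub>0 > 0"
    and brownian_W: "standard_brownian_motion M F W"
    and brownian_Z: "standard_brownian_motion M F Z"
    and indep_W_Z: "independent_processes M W Z"
    and S_adapted: "continuous_adapted M F S"
    and \<sigma>_adapted: "continuous_adapted M F \<sigma>"
    and S_init: "AE x in M. S 0 x = S\<^sub>0"
    and \<sigma>_init: "AE x in M. \<sigma> 0 x = \<sigma>\<^sub>0"
    and S_sde: "has_ito_integral M W (\<lambda>t x. \<sigma> t x * S t x) (\<lambda>t x. S t x - S\<^sub>0)"
    and \<sigma>_sde: "has_ito_integral M Z \<sigma> (\<lambda>t x. \<sigma> t x - \<sigma>\<^sub>0)"

definition atm_time_value ::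
    "'a measure \<Rightarrow> (real \<Rightarrow> 'a \<Rightarrow> real) \<Rightarrow> real \<Rightarrow> real \<Rightarrow> real" where
  "atm_time_value M S S\<^sub>0 T = (LINT x|M. max (S T x - S\<^sub>0) 0)"

definition sabr_h :: "real \<Rightarrow> real \<Rightarrow> real" where
  "sabr_h \<sigma>\<^sub>0 s = (if s = 0 then \<sigma>\<^sub>0 / 2 else sin (\<sigma>\<^sub>0 / 2 * sinh s) / sinh s)"

definition sabr_g :: "real \<Rightarrow> real \<Rightarrow> real" where
  "sabr_g \<sigma>\<^sub>0 u = sinh u * (LBINT s:{0<..<u}. sabr_h \<sigma>\<^sub>0 s / sqrt (cosh u - cosh s))"

definition sabr_atm_integral :: "real \<Rightarrow> real \<Rightarrow> real \<Rightarrow> real" where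
  "sabr_atm_integral S\<^sub>0 \<sigma>\<^sub>0 T =
     2 * S\<^sub>0 * exp (- T / 8) / (pi powr (3 / 2) * sqrt T) *
     (LBINT u:{0<..}. exp (- (u\<^sup>2 / (2 * T))) * sabr_g \<sigma>\<^sub>0 u)"

definition asymp_power_series_at_right_0 :: "(real \<Rightarrow> real) \<Rightarrow> (nat \<Rightarrow> real) \<Rightarrow> bool" where
  "asymp_power_series_at_right_0 f c \<longleftrightarrow>
     (\<forall>N. (\<lambda>T. f T - (\<Sum>k\<le>N. c k * T ^ k)) \<in> O[at_right 0](\<lambda>T. T ^ (N + 1)))"

end

theory Submission
  imports Defs "HOL-Complex_Analysis.Complex_Analysis" "HOL-Real_Asymp.Real_Asymp"
begin

text \<open>
  The substitution \<open>sinh (s / 2) = sinh (u / 2) * sin \<theta>\<close> turns the singular integral in \<open>g\<close> into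
  an integral over \<open>[0, \<pi>/2]\<close> that is holomorphic in \<open>w = sinh (u / 2)\<close> for \<open>\<bar>w\<bar> < 1\<close>. Hence \<open>g\<close> is
  odd and analytic near \<open>0\<close>, \<open>g(u) = \<Sum> c\<^sub>k u\<^sup>2\<^sup>k\<^sup>+\<^sup>1\<close>, and, since \<open>g(u) = O(e\<^sup>u)\<close>, Watson's lemma yields
  the asymptotic series with coefficients \<open>c\<^sub>k 2\<^sup>k k!\<close>, up to a constant and the factor \<open>exp (- T / 8)\<close>.

  If this series had a positive radius of convergence, \<open>\<Sum> c\<^sub>k z\<^sup>2\<^sup>k\<^sup>+\<^sup>1\<close> would be entire. But along the
  imaginary axis \<open>g(iy)\<close> equals, up to a constant factor, \<open>sin y\<close> times an integral that diverges
  logarithmically as \<open>y\<close> tends to \<open>\<pi>\<close>. So the entire function would vanish at \<open>i\<pi>\<close>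
  without being differentiable there.
\<close>

section \<open>The kernel after substitution\<close>

text \<open>With \<open>a = \<sigma> / 2\<close> and \<open>\<xi> = sinh s\<close> this is
  \<open>sabr_h \<sigma> s\<close>, so h becomes an entire function of \<open>sinh s\<close>, with
  the removable singularity filled by its limit.\<close>

definition sin_quot :: "real \<Rightarrow> complex \<Rightarrow> complex" where
  "sin_quot a \<xi> = (if \<xi> = 0 then of_real a else sin (of_real a * \<xi>) / \<xi>)"

text \<open>A difference quotient at 0 of an entire function stays holomorphic once its value there
  is set to the derivative, here \<open>a\<close>.\<close>

lemma holomorphic_sin_quot: "sin_quot a holomorphic_on UNIV"
proof -
  have "((\<lambda>\<xi>. sin (of_real a * \<xi>)) has_field_derivative of_real a) (at (0 :: complex))"
    by (auto intro!: derivative_eq_intros)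
  then have "deriv (\<lambda>\<xi>. sin (of_real a * \<xi>)) (0 :: complex) = of_real a"
    by (rule DERIV_imp_deriv)
  moreover have "(\<lambda>\<xi>. sin (of_real a * \<xi>)) holomorphic_on (UNIV :: complex set)"
    by (intro holomorphic_intros)
  from pole_lemma_open[OF this, of 0]
  have "(\<lambda>z. if z = 0 then deriv (\<lambda>\<xi>. sin (of_real a * \<xi>)) (0 :: complex)
          else (sin (of_real a * z) - sin (of_real a * 0)) / (z - 0)) holomorphic_on UNIV"
    by simp
  ultimately show ?thesis
    unfolding sin_quot_def by (simp add: fun_eq_iff cong: if_cong)
qed

text \<open>For \<open>x = sinh (s / 2)\<close> one has
  \<open>csqrt (1 + x\<^sup>2) = cosh (s / 2)\<close> and
  \<open>2 * x * csqrt (1 + x\<^sup>2) = sinh s\<close>. The kernel is thus h(s) / cosh (s / 2),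
  where the division by \<open>cosh (s / 2)\<close> comes from the Jacobian of s as a function of
  x.\<close>

definition sabr_kernel :: "real \<Rightarrow> complex \<Rightarrow> complex" where
  "sabr_kernel a x = sin_quot a (2 * x * csqrt (1 + x\<^sup>2)) / csqrt (1 + x\<^sup>2)"

lemma one_plus_square_notin_nonpos_Reals:
  assumes "norm (x :: complex) < 1"
  shows "1 + x\<^sup>2 \<notin> \<real>\<^sub>\<le>\<^sub>0"
proof -
  have "norm (x\<^sup>2) < 1"
    using assms by (simp add: norm_power power_less_one_iff)
  then have "Re (x\<^sup>2) > -1"
    using abs_Re_le_cmod[of "x\<^sup>2"] by linarith
  then show ?thesis
    by (auto simp: complex_nonpos_Reals_iff)
qed

text \<open>Inside the unit ball \<open>1 + x\<^sup>2\<close> avoids the branch cut of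
  \<open>csqrt\<close>; the points x = i and x = -i, where it vanishes, lie on the boundary and
  cause the later singularity.\<close>

lemma holomorphic_sabr_kernel: "sabr_kernel a holomorphic_on ball 0 1"
proof -
  have nz: "1 + x\<^sup>2 \<notin> \<real>\<^sub>\<le>\<^sub>0" if "x \<in> ball (0 :: complex) 1" for x
    using that by (intro one_plus_square_notin_nonpos_Reals) simp
  have "(\<lambda>x. sin_quot a (2 * x * csqrt (1 + x\<^sup>2))) holomorphic_on ball 0 1"
    using nz
    by (intro holomorphic_on_compose_gen[OF _ holomorphic_sin_quot, unfolded o_def] holomorphic_intros) auto
  moreover have "csqrt (1 + x\<^sup>2) \<noteq> 0" if "x \<in> ball (0 :: complex) 1" for x
    using nz[OF that] by auto
  ultimately show ?thesis
    unfolding sabr_kernel_def using nz by (intro holomorphic_intros) auto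
qed

lemma sabr_kernel_uminus [simp]: "sabr_kernel a (- x) = sabr_kernel a x"
  by (simp add: sabr_kernel_def sin_quot_def)

section \<open>Values of the kernel on the real and imaginary axes\<close>

lemma sinh_of_real: "sinh (of_real x :: complex) = of_real (sinh x)"
  by (simp add: sinh_def exp_of_real scaleR_conv_of_real flip: of_real_minus)

lemma sinh_two_arsinh: "sinh (2 * arsinh x) = 2 * x * sqrt (1 + x\<^sup>2)" for x :: real
  by (simp add: sinh_double cosh_arsinh_real add.commute)

lemma csqrt_one_plus_of_real_square:
  "csqrt (1 + (of_real x)\<^sup>2) = of_real (sqrt (1 + x\<^sup>2))"
  by (subst of_real_sqrt) auto

lemma one_plus_square_pos: "0 < 1 + (x :: real)\<^sup>2"
  by (simp add: add_pos_nonneg)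

lemma sabr_kernel_of_real:
  "sabr_kernel (\<sigma> / 2) (of_real x) = of_real (sabr_h \<sigma> (2 * arsinh x) / sqrt (1 + x\<^sup>2))"
  using one_plus_square_pos[of x]
  unfolding sabr_kernel_def sin_quot_def sabr_h_def sinh_two_arsinh csqrt_one_plus_of_real_square
  by (auto simp flip: sin_of_real)

lemma abs_sabr_h_le:
  assumes "\<sigma> \<ge> 0"
  shows "\<bar>sabr_h \<sigma> s\<bar> \<le> \<sigma> / 2"
proof (cases "s = 0")
  case False
  have "\<bar>sin (\<sigma> / 2 * sinh s)\<bar> \<le> \<bar>\<sigma> / 2 * sinh s\<bar>"
    by (rule abs_sin_x_le_abs_x)
  with False assms show ?thesis
    by (simp add: sabr_h_def abs_mult field_simps)
qed (use assms in \<open>simp add: sabr_h_def\<close>)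

lemma sinh_ge_self: "x \<ge> 0 \<Longrightarrow> sinh x \<ge> (x :: real)"
  by (rule DERIV_nonneg_imp_nondecreasing[of 0 x "\<lambda>x. sinh x - x", simplified])
     (auto intro!: exI derivative_eq_intros simp: cosh_real_ge_1)

lemma sinh_le_self_mult_cosh: "x \<ge> 0 \<Longrightarrow> sinh x \<le> (x :: real) * cosh x"
  by (rule DERIV_nonneg_imp_nondecreasing[of 0 x "\<lambda>x. x * cosh x - sinh x", simplified])
     (auto intro!: exI derivative_eq_intros)

text \<open>On the imaginary axis the sine turns into a hyperbolic sine, so the kernel is positive
  and no cancellation can occur. With \<open>d = sqrt (1 - \<rho>\<^sup>2)\<close> and
  \<open>\<tau> = 2 * \<rho> * d\<close>, the numerator \<open>sinh (a * \<tau>) / \<tau>\<close>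
  stays between positive constants, which leaves 1 / d as the exact order of growth as
  \<open>\<rho>\<close> tends to 1.\<close>

lemma sabr_kernel_imaginary:
  assumes a: "a > 0" and \<rho>: "0 \<le> \<rho>" "\<rho> < 1"
  obtains \<kappa> where "a \<le> \<kappa>" "\<kappa> \<le> a * cosh a"
    "sabr_kernel a (\<i> * of_real \<rho>) = of_real (\<kappa> / sqrt (1 - \<rho>\<^sup>2))"
proof -
  define d where "d = sqrt (1 - \<rho>\<^sup>2)"
  have \<rho>2: "\<rho>\<^sup>2 < 1"
    using \<rho> by (simp add: power_less_one_iff)
  then have d: "d > 0" "d\<^sup>2 = 1 - \<rho>\<^sup>2"
    by (auto simp: d_def)
  define \<tau> where "\<tau> = 2 * \<rho> * d"
  have \<tau>: "\<tau> \<ge> 0"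
    using \<rho> d by (simp add: \<tau>_def)
  \<comment> \<open>From \<open>\<rho>\<^sup>2 + d\<^sup>2 = 1\<close> and the nonnegative square of
    \<open>\<rho> - d\<close>.\<close>
  have "\<tau> \<le> 1"
    using d(2) sum_squares_ge_zero[of "\<rho> - d" 0]
    by (simp add: \<tau>_def power2_eq_square algebra_simps)
  have "1 + (\<i> * of_real \<rho>)\<^sup>2 = complex_of_real (1 - \<rho>\<^sup>2)"
    by (simp add: power_mult_distrib)
  then have sq: "csqrt (1 + (\<i> * of_real \<rho>)\<^sup>2) = of_real d"
    using \<rho>2 unfolding d_def by (subst of_real_sqrt) auto
  define \<kappa> where "\<kappa> = (if \<tau> = 0 then a else sinh (a * \<tau>) / \<tau>)"
  have arg: "2 * (\<i> * of_real \<rho>) * of_real d = \<i> * complex_of_real \<tau>"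
    by (simp add: \<tau>_def)
  have "sin (of_real a * (\<i> * complex_of_real \<tau>)) = \<i> * of_real (sinh (a * \<tau>))"
    using sinh_of_real[of "a * \<tau>"]
    by (simp add: sin_conv_sinh mult_ac minus_equation_iff flip: of_real_mult)
  then have "sin_quot a (2 * (\<i> * of_real \<rho>) * of_real d) = of_real \<kappa>"
    unfolding sin_quot_def arg by (simp add: \<kappa>_def)
  then have "sabr_kernel a (\<i> * of_real \<rho>) = of_real (\<kappa> / d)"
    unfolding sabr_kernel_def sq by simp
  moreover have "a \<le> \<kappa>"
    using sinh_ge_self[of "a * \<tau>"] \<tau> a by (auto simp: \<kappa>_def field_simps)
  moreover have "\<kappa> \<le> a * cosh a"
  proof (cases "\<tau> = 0")
    case False
    have "a * \<tau> \<le> a"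
      using \<open>\<tau> \<le> 1\<close> a by simp
    then have "cosh (a * \<tau>) \<le> cosh a"
      using a \<tau> by (simp add: cosh_real_nonneg_le_iff)
    then have "sinh (a * \<tau>) \<le> a * \<tau> * cosh a"
      using sinh_le_self_mult_cosh[of "a * \<tau>"] a \<tau> mult_left_mono[of "cosh (a * \<tau>)" "cosh a" "a * \<tau>"]
      by (smt (verit) mult_nonneg_nonneg)
    then show ?thesis
      using False \<tau> by (simp add: \<kappa>_def field_simps)
  qed (use a cosh_real_ge_1[of a] in \<open>simp add: \<kappa>_def\<close>)
  ultimately show ?thesis
    using that by (simp add: d_def)
qed

section \<open>The integral over \<theta> and the analytic continuation of g\<close>

definition sabr_theta_integral :: "real \<Rightarrow> complex \<Rightarrow> complex" where
  "sabr_theta_integral a w = integral {0..pi/2} (\<lambda>\<theta>. sabr_kernel a (w * of_real (sin \<theta>)))"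

lemma mult_of_real_sin_in_ball:
  assumes "w \<in> ball (0 :: complex) 1"
  shows "w * of_real (sin \<theta>) \<in> ball 0 1"
  using assms mult_left_mono[OF abs_sin_le_one[of \<theta>], of "norm w"] by (simp add: norm_mult)

text \<open>For \<open>norm w < 1\<close> the argument \<open>w * sin \<theta>\<close> never leaves
  the ball where the kernel is holomorphic, so differentiation under the integral sign
  applies.\<close>

lemma holomorphic_sabr_theta_integral: "sabr_theta_integral a holomorphic_on ball 0 1"
proof -
  have "(\<lambda>w. integral (cbox 0 (pi/2)) (\<lambda>\<theta>. sabr_kernel a (w * of_real (sin \<theta>)))) holomorphic_on ball 0 1"
  proof (rule leibniz_rule_holomorphic)
    fix w :: complex and \<theta> :: real
    assume w: "w \<in> ball 0 1"
    have "(sabr_kernel a has_field_derivative deriv (sabr_kernel a) (w * of_real (sin \<theta>)))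
        (at (w * of_real (sin \<theta>)))"
      using holomorphic_derivI[OF holomorphic_sabr_kernel open_ball mult_of_real_sin_in_ball[OF w]] .
    then show "((\<lambda>w. sabr_kernel a (w * of_real (sin \<theta>))) has_field_derivative
        deriv (sabr_kernel a) (w * of_real (sin \<theta>)) * of_real (sin \<theta>)) (at w within ball 0 1)"
      by (rule DERIV_chain2) (auto intro!: derivative_eq_intros)
  next
    fix w :: complex
    assume w: "w \<in> ball 0 1"
    show "(\<lambda>\<theta>. sabr_kernel a (w * of_real (sin \<theta>))) integrable_on cbox 0 (pi/2)"
      using mult_of_real_sin_in_ball[OF w]
      by (intro integrable_continuous continuous_on_compose2[OF holomorphic_on_imp_continuous_on[OF holomorphic_sabr_kernel]]
            continuous_intros) auto
  next
    have cont: "continuous_on (ball 0 1) (deriv (sabr_kernel a))"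
      by (intro holomorphic_on_imp_continuous_on holomorphic_deriv holomorphic_sabr_kernel open_ball)
    show "continuous_on (ball 0 1 \<times> cbox 0 (pi/2))
        (\<lambda>(w, \<theta>). deriv (sabr_kernel a) (w * of_real (sin \<theta>)) * of_real (sin \<theta>))"
      unfolding case_prod_unfold
    proof (rule continuous_on_mult[OF continuous_on_compose2[OF cont]])
      show "(\<lambda>p. fst p * of_real (sin (snd p))) ` (ball 0 1 \<times> cbox 0 (pi/2)) \<subseteq> ball (0 :: complex) 1"
        using mult_of_real_sin_in_ball by fastforce
    qed (intro continuous_intros)+
  qed auto
  then show ?thesis
    unfolding sabr_theta_integral_def by simp
qed

lemma sabr_theta_integral_uminus [simp]: "sabr_theta_integral a (- w) = sabr_theta_integral a w"
  by (simp add: sabr_theta_integral_def)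

definition sabr_g_complex :: "real \<Rightarrow> complex \<Rightarrow> complex" where
  "sabr_g_complex a z = of_real (sqrt 2) * sinh z * sabr_theta_integral a (sinh (z / 2))"

text \<open>The integral over \<theta> is even in w because the kernel is even, so the factor
  \<open>sinh z\<close> makes the product odd. This is why only odd powers of u enter the expansion
  of g.\<close>

lemma sabr_g_complex_uminus: "sabr_g_complex a (- z) = - sabr_g_complex a z"
  by (simp add: sabr_g_complex_def)

section \<open>The real integral: continuity, substitution and growth\<close>

lemma continuous_on_sabr_h_div:
  "continuous_on UNIV (\<lambda>x. sabr_h \<sigma> (2 * arsinh x) / sqrt (1 + x\<^sup>2))"
proof -
  \<comment> \<open>For real x the square root is real and positive, so continuity holds on the
    whole line and not only in the unit ball; continuity at x = 0 comes from \<open>sin_quot\<close>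
    being entire.\<close>
  have "continuous_on UNIV (\<lambda>x. sabr_kernel (\<sigma> / 2) (complex_of_real x))"
    unfolding sabr_kernel_def csqrt_one_plus_of_real_square
    using one_plus_square_pos
    by (intro continuous_intros continuous_on_compose2[OF holomorphic_on_imp_continuous_on[OF holomorphic_sin_quot]])
       (auto simp: less_imp_neq[symmetric] order.strict_iff_not)
  then have "continuous_on UNIV (\<lambda>x. Re (complex_of_real (sabr_h \<sigma> (2 * arsinh x) / sqrt (1 + x\<^sup>2))))"
    unfolding sabr_kernel_of_real by (intro continuous_on_Re)
  then show ?thesis
    by simp
qed

lemma continuous_on_sabr_theta_integrand:
  "continuous_on A (\<lambda>\<theta>. sabr_h \<sigma> (2 * arsinh (w * sin \<theta>)) / sqrt (1 + (w * sin \<theta>)\<^sup>2))"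
  by (rule continuous_on_compose2[OF continuous_on_sabr_h_div, of _ "\<lambda>\<theta>. w * sin \<theta>"]) (auto intro!: continuous_intros)

lemma borel_measurable_sabr_h [measurable]: "sabr_h \<sigma> \<in> borel_measurable borel"
proof -
  have [measurable]: "(sinh :: real \<Rightarrow> real) \<in> borel_measurable borel"
    by (intro borel_measurable_continuous_onI continuous_intros)
  show ?thesis
    unfolding sabr_h_def by measurable
qed

text \<open>The substitution \<open>sinh (s / 2) = sinh (u / 2) * sin \<theta>\<close> removes the endpoint singularity.\<close>

lemma sabr_g_eq_theta_integral:
  assumes u: "u > 0"
  defines "w \<equiv> sinh (u / 2)"
  shows "sabr_g \<sigma> u = sqrt 2 * sinh u *
    integral {0..pi/2} (\<lambda>\<theta>. sabr_h \<sigma> (2 * arsinh (w * sin \<theta>)) / sqrt (1 + (w * sin \<theta>)\<^sup>2))"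
proof -
  define f where "f s = sabr_h \<sigma> s / sqrt (cosh u - cosh s)" for s
  define s where "s \<theta> = 2 * arsinh (w * sin \<theta>)" for \<theta>
  define s' where "s' \<theta> = 2 * w * cos \<theta> / sqrt (1 + (w * sin \<theta>)\<^sup>2)" for \<theta>
  let ?S = "{0<..<pi/2}"
  let ?k = "\<lambda>\<theta>. sabr_h \<sigma> (s \<theta>) / sqrt (1 + (w * sin \<theta>)\<^sup>2)"
  have w: "w > 0"
    using u by (simp add: w_def)
  have deriv: "(s has_field_derivative s' \<theta>) (at \<theta> within ?S)" for \<theta>
    unfolding s_def s'_def by (auto intro!: derivative_eq_intros DERIV_chain2[OF arsinh_real_has_field_derivative] simp: add.commute)
  have sin_less: "sin \<theta> < sin \<theta>'" if "0 < \<theta>" "\<theta> < \<theta>'" "\<theta>' < pi/2" for \<theta> \<theta>'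
    using that by (intro sin_monotone_2pi) auto
  have inj: "inj_on s ?S"
  proof (rule linorder_inj_onI)
    fix \<theta> \<theta>' assume "\<theta> < \<theta>'" "\<theta> \<in> ?S" "\<theta>' \<in> ?S"
    then show "s \<theta> \<noteq> s \<theta>'"
      using sin_less[of \<theta> \<theta>'] w by (simp add: s_def less_imp_neq)
  qed auto
  have image: "s ` ?S = {0<..<u}"
  proof (intro equalityI subsetI)
    fix t assume "t \<in> s ` ?S"
    then obtain \<theta> where \<theta>: "0 < \<theta>" "\<theta> < pi/2" "t = s \<theta>"
      by auto
    have "sin \<theta> > 0" "sin \<theta> < 1"
      using \<theta> sin_gt_zero[of \<theta>] sin_monotone_2pi[of \<theta> "pi/2"] by auto
    then have "0 < arsinh (w * sin \<theta>)" "arsinh (w * sin \<theta>) < arsinh w"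
      using w by auto
    then show "t \<in> {0<..<u}"
      using \<theta> by (simp add: s_def w_def arsinh_sinh_real)
  next
    fix t assume t: "t \<in> {0<..<u}"
    define y where "y = sinh (t / 2) / w"
    have y: "0 < y" "y < 1"
      using t w by (auto simp: y_def w_def)
    have "s (arcsin y) = t"
      using y w by (simp add: s_def) (simp add: y_def arsinh_sinh_real)
    moreover have "arcsin y \<in> ?S"
      using y arcsin_less_arcsin[of 0 y] arcsin_less_arcsin[of y 1] by auto
    ultimately show "t \<in> s ` ?S"
      by force
  qed
  \<comment> \<open>The half-argument formula gives
    \<open>cosh u - cosh (s \<theta>) = 2 * (w * cos \<theta>)\<^sup>2\<close>. Its root cancels the
    factor \<open>w * cos \<theta>\<close> of the Jacobian, which is how the endpoint singularity
    disappears.\<close>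
  have integrand: "\<bar>s' \<theta>\<bar> * f (s \<theta>) = sqrt 2 * ?k \<theta>" if \<theta>: "\<theta> \<in> ?S" for \<theta>
  proof -
    have c: "cos \<theta> > 0"
      using \<theta> by (intro cos_gt_zero_pi) auto
    have "cosh u = cosh (2 * (u / 2))"
      by simp
    also have "\<dots> = 1 + 2 * w\<^sup>2"
      unfolding cosh_double w_def by (simp add: cosh_square_eq)
    finally have "cosh u - cosh (s \<theta>) = 2 * w\<^sup>2 * (1 - (sin \<theta>)\<^sup>2)"
      unfolding s_def cosh_double by (simp add: cosh_square_eq algebra_simps)
    also have "\<dots> = 2 * (w * cos \<theta>)\<^sup>2"
      by (simp add: cos_squared_eq power_mult_distrib)
    finally have "sqrt (cosh u - cosh (s \<theta>)) = sqrt 2 * (w * cos \<theta>)"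
      using w c by (simp add: real_sqrt_mult)
    moreover have "\<bar>s' \<theta>\<bar> = s' \<theta>"
      using w c by (simp add: s'_def)
    ultimately have "\<bar>s' \<theta>\<bar> * f (s \<theta>) = (2 / sqrt 2) * ?k \<theta>"
      using w c unfolding f_def s'_def by simp
    then show ?thesis
      by (simp add: real_div_sqrt)
  qed
  have cont: "continuous_on {0..pi/2} (\<lambda>\<theta>. sqrt 2 * ?k \<theta>)"
    unfolding s_def by (rule continuous_on_mult_left[OF continuous_on_sabr_theta_integrand])
  have "(\<lambda>\<theta>. sqrt 2 * ?k \<theta>) absolutely_integrable_on ?S"
    by (rule set_integrable_subset[OF absolutely_integrable_continuous_real[OF cont]]) auto
  then have "(\<lambda>\<theta>. \<bar>s' \<theta>\<bar> * f (s \<theta>)) absolutely_integrable_on ?S"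
    by (rule set_integrable_cong[THEN iffD1, rotated -1]) (use integrand in auto)
  moreover have "integral ?S (\<lambda>\<theta>. \<bar>s' \<theta>\<bar> * f (s \<theta>)) = sqrt 2 * integral {0..pi/2} ?k"
  proof -
    have "integral ?S (\<lambda>\<theta>. \<bar>s' \<theta>\<bar> * f (s \<theta>)) = integral ?S (\<lambda>\<theta>. sqrt 2 * ?k \<theta>)"
      using integrand by (intro integral_cong) auto
    also have "\<dots> = sqrt 2 * integral ?S ?k"
      by (rule integral_mult_right)
    also have "integral ?S ?k = integral {0..pi/2} ?k"
      by (rule integral_open_interval_real [symmetric])
    finally show ?thesis .
  qed
  moreover have "?S \<in> sets lebesgue"
    by simp
  ultimately have "f absolutely_integrable_on s ` ?S \<and> integral (s ` ?S) f = sqrt 2 * integral {0..pi/2} ?k"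
    using has_absolute_integral_change_of_variables_1'[OF _ deriv inj] by blast
  then have *: "f absolutely_integrable_on {0<..<u}" "integral {0<..<u} f = sqrt 2 * integral {0..pi/2} ?k"
    unfolding image by blast+
  have [measurable]: "f \<in> borel_measurable borel"
  proof -
    have [measurable]: "(cosh :: real \<Rightarrow> real) \<in> borel_measurable borel"
      by (intro borel_measurable_continuous_onI continuous_intros)
    show ?thesis
      unfolding f_def by measurable
  qed
  \<comment> \<open>The change of variables works with the completed measure; Borel measurability of
    f brings integrability back to \<open>lborel\<close>, over which \<open>sabr_g\<close>
    integrates.\<close>
  have "set_integrable lborel {0<..<u} f"
    using *(1) unfolding set_integrable_def by (subst (asm) integrable_completion) auto
  from set_borel_integral_eq_integral(2)[OF this] *(2) show ?thesis
    unfolding sabr_g_def f_def s_def by simp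
qed

lemma sabr_theta_integral_of_real:
  "sabr_theta_integral (\<sigma> / 2) (of_real w) =
     of_real (integral {0..pi/2} (\<lambda>\<theta>. sabr_h \<sigma> (2 * arsinh (w * sin \<theta>)) / sqrt (1 + (w * sin \<theta>)\<^sup>2)))"
proof -
  have "((\<lambda>\<theta>. sabr_h \<sigma> (2 * arsinh (w * sin \<theta>)) / sqrt (1 + (w * sin \<theta>)\<^sup>2)) has_integral
      integral {0..pi/2} (\<lambda>\<theta>. sabr_h \<sigma> (2 * arsinh (w * sin \<theta>)) / sqrt (1 + (w * sin \<theta>)\<^sup>2))) {0..pi/2}"
    using continuous_on_sabr_theta_integrand by (intro integrable_integral integrable_continuous_real)
  from has_integral_of_real[OF this, where ?'b = complex] show ?thesis
    unfolding sabr_theta_integral_def sabr_kernel_of_real [symmetric] of_real_mult by (rule integral_unique)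
qed

text \<open>This holds for every u > 0, also where \<open>sinh (u / 2) \<ge> 1\<close>, since the
  kernel agrees with its real form on the whole real axis.\<close>

lemma sabr_g_complex_of_real:
  assumes "u > 0"
  shows "sabr_g_complex (\<sigma> / 2) (of_real u) = of_real (sabr_g \<sigma> u)"
proof -
  have "sinh (complex_of_real u / 2) = of_real (sinh (u / 2))"
    using sinh_of_real[of "u / 2"] by simp
  then show ?thesis
    unfolding sabr_g_eq_theta_integral[OF assms] sabr_g_complex_def
    by (simp add: sabr_theta_integral_of_real sinh_of_real)
qed

text \<open>On the real axis the integrand over \<theta> is at most \<open>\<sigma> / 2\<close> in
  absolute value, so only \<open>sinh u\<close> grows. The exponential bound is what lets the
  Gaussian weight control the tail in Watson's lemma.\<close>

lemma abs_sabr_g_le: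
  assumes "\<sigma> \<ge> 0" "u > 0"
  shows "\<bar>sabr_g \<sigma> u\<bar> \<le> \<sigma> * pi * exp u"
proof -
  let ?k = "\<lambda>\<theta>. sabr_h \<sigma> (2 * arsinh (sinh (u / 2) * sin \<theta>)) / sqrt (1 + (sinh (u / 2) * sin \<theta>)\<^sup>2)"
  have "norm (integral {0..pi/2} ?k) \<le> \<sigma> / 2 * (pi / 2 - 0)"
  proof (rule integral_bound)
    fix \<theta> :: real
    have "\<bar>?k \<theta>\<bar> \<le> \<bar>sabr_h \<sigma> (2 * arsinh (sinh (u / 2) * sin \<theta>))\<bar> / 1"
      unfolding abs_divide using one_plus_square_pos by (intro divide_left_mono) auto
    then show "norm (?k \<theta>) \<le> \<sigma> / 2"
      using abs_sabr_h_le[OF assms(1), of "2 * arsinh (sinh (u / 2) * sin \<theta>)"]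
      unfolding real_norm_def by linarith
  qed (use continuous_on_sabr_theta_integrand in auto)
  moreover have "0 \<le> sinh u" "sinh u \<le> exp u / 2"
    using assms(2) by (auto simp: sinh_def)
  moreover have "sqrt 2 \<le> 2"
    using real_sqrt_le_mono[of 2 4] by simp
  ultimately have "\<bar>sqrt 2 * sinh u * integral {0..pi/2} ?k\<bar> \<le> 2 * (exp u / 2) * (\<sigma> / 2 * (pi / 2))"
    unfolding abs_mult by (intro mult_mono) auto
  also have "\<dots> \<le> \<sigma> * pi * exp u"
    using assms(1) by simp
  finally show ?thesis
    unfolding sabr_g_eq_theta_integral[OF assms(2)] .
qed

lemma continuous_on_sabr_g: "continuous_on {0<..} (sabr_g \<sigma>)"
proof -
  have "continuous_on {0<..} (\<lambda>u. integral (cbox 0 (pi/2))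
      (\<lambda>\<theta>. sabr_h \<sigma> (2 * arsinh (sinh (u / 2) * sin \<theta>)) / sqrt (1 + (sinh (u / 2) * sin \<theta>)\<^sup>2)))"
    by (intro integral_continuous_on_param, unfold case_prod_unfold,
        rule continuous_on_compose2[OF continuous_on_sabr_h_div, where f = "\<lambda>p. sinh (fst p / 2) * sin (snd p)"])
       (auto intro!: continuous_intros)
  then have "continuous_on {0<..} (\<lambda>u. sqrt 2 * sinh u * integral {0..pi/2}
      (\<lambda>\<theta>. sabr_h \<sigma> (2 * arsinh (sinh (u / 2) * sin \<theta>)) / sqrt (1 + (sinh (u / 2) * sin \<theta>)\<^sup>2)))"
    by (intro continuous_intros) simp
  then show ?thesis
    by (rule continuous_on_eq) (simp add: sabr_g_eq_theta_integral)
qed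

section \<open>Watson's lemma and asymptotic power series\<close>

text \<open>Rescaling u by \<open>sqrt c\<close> reduces the claim to c = 1. With
  \<open>c = 2 * T\<close> these moments supply the factorials that make the final series
  diverge.\<close>

lemma has_bochner_integral_gaussian_odd_moment:
  assumes "(c :: real) > 0"
  shows "has_bochner_integral lborel
    (\<lambda>u. indicator {0<..} u *\<^sub>R (exp (- (u\<^sup>2 / c)) * u ^ (2 * k + 1))) (c ^ (k + 1) * fact k / 2)"
proof -
  define f where "f u = indicator {0..} u *\<^sub>R (exp (- u\<^sup>2) * u ^ (2 * k + 1))" for u :: real
  have "has_bochner_integral lborel (\<lambda>u. f (0 + 1 / sqrt c * u)) (fact k / 2 /\<^sub>R \<bar>1 / sqrt c\<bar>)"
    using gaussian_moment_odd_pos[of k] assms unfolding f_def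
    by (subst lborel_has_bochner_integral_real_affine_iff [symmetric]) auto
  then have "has_bochner_integral lborel (\<lambda>u. f (0 + 1 / sqrt c * u) * sqrt c ^ (2 * k + 1))
      ((fact k / 2 /\<^sub>R \<bar>1 / sqrt c\<bar>) * sqrt c ^ (2 * k + 1))"
    by (rule has_bochner_integral_mult_left)
  moreover have "f (0 + 1 / sqrt c * u) * sqrt c ^ (2 * k + 1) =
      indicator {0<..} u *\<^sub>R (exp (- (u\<^sup>2 / c)) * u ^ (2 * k + 1))" for u
    using assms by (auto simp: f_def indicator_def power_divide zero_le_divide_iff)
  moreover have "(fact k / 2 /\<^sub>R \<bar>1 / sqrt c\<bar>) * sqrt c ^ (2 * k + 1) = c ^ (k + 1) * fact k / 2"
  proof -
    have "sqrt c ^ (2 * k + 1) = (sqrt c ^ 2) ^ k * sqrt c"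
      by (simp only: power_add power_mult power_one_right)
    then show ?thesis
      using assms by simp
  qed
  ultimately show ?thesis
    by (simp only:)
qed

text \<open>The polynomial part integrates exactly to Gaussian moments. In the error the factor
  \<open>exp u\<close> is absorbed by widening the Gaussian from 2T to 4T, at the price of a factor
  \<open>exp T\<close>.\<close>

lemma watson_remainder:
  fixes g :: "real \<Rightarrow> real"
  assumes meas: "set_borel_measurable lborel {0<..} g"
    and remainder: "\<And>u. u > 0 \<Longrightarrow> \<bar>g u - (\<Sum>k\<le>N. c k * u ^ (2 * k + 1))\<bar> \<le> C * (u ^ (2 * (N + 1) + 1) * exp u)"
    and T: "T > 0"
  shows "\<bar>(LBINT u:{0<..}. exp (- (u\<^sup>2 / (2 * T))) * g u) - (\<Sum>k\<le>N. c k * ((2 * T) ^ (k + 1) * fact k / 2))\<bar>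
    \<le> C * exp T * ((4 * T) ^ (N + 2) * fact (N + 1) / 2)"
proof -
  define p where "p u = (\<Sum>k\<le>N. c k * u ^ (2 * k + 1))" for u
  let ?e = "\<lambda>u. exp (- (u\<^sup>2 / (2 * T)))"
  let ?i = "indicator {0<..} :: real \<Rightarrow> real"
  have "has_bochner_integral lborel (\<lambda>u. \<Sum>k\<le>N. c k * (?i u *\<^sub>R (?e u * u ^ (2 * k + 1))))
      (\<Sum>k\<le>N. c k * ((2 * T) ^ (k + 1) * fact k / 2))"
    using T by (intro has_bochner_integral_sum has_bochner_integral_mult_right
        has_bochner_integral_gaussian_odd_moment) auto
  also have "(\<lambda>u. \<Sum>k\<le>N. c k * (?i u *\<^sub>R (?e u * u ^ (2 * k + 1)))) = (\<lambda>u. ?i u *\<^sub>R (?e u * p u))"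
    by (simp add: p_def sum_distrib_left mult_ac)
  finally have p: "has_bochner_integral lborel (\<lambda>u. ?i u *\<^sub>R (?e u * p u))
      (\<Sum>k\<le>N. c k * ((2 * T) ^ (k + 1) * fact k / 2))" .
  define m where "m u = C * exp T * (?i u *\<^sub>R (exp (- (u\<^sup>2 / (4 * T))) * u ^ (2 * (N + 1) + 1)))" for u
  have m: "has_bochner_integral lborel m (C * exp T * ((4 * T) ^ (N + 2) * fact (N + 1) / 2))"
    unfolding m_def using has_bochner_integral_gaussian_odd_moment[of "4 * T" "N + 1"] T
    by (intro has_bochner_integral_mult_right) auto
  define r where "r u = ?i u *\<^sub>R (?e u * (g u - p u))" for u
  have r_le: "norm (r u) \<le> m u" for u
  proof (cases "u > 0")
    case True
    \<comment> \<open>Expanding this square and dividing by 4T bounds u by half of the Gaussian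
      exponent plus T.\<close>
    have "0 \<le> (u - 2 * T)\<^sup>2"
      by simp
    then have "u \<le> u\<^sup>2 / (4 * T) + T"
      using T by (simp add: field_simps power2_eq_square)
    moreover have "u\<^sup>2 / (2 * T) = 2 * (u\<^sup>2 / (4 * T))"
      by simp
    ultimately have "- (u\<^sup>2 / (2 * T)) + u \<le> - (u\<^sup>2 / (4 * T)) + T"
      by linarith
    then have exp_le: "?e u * exp u \<le> exp (- (u\<^sup>2 / (4 * T))) * exp T"
      unfolding exp_add [symmetric] by simp
    have le: "\<bar>g u - p u\<bar> \<le> C * (u ^ (2 * (N + 1) + 1) * exp u)"
      using remainder[OF True] by (simp add: p_def)
    then have "0 \<le> C * (u ^ (2 * (N + 1) + 1) * exp u)"
      by linarith
    moreover have "0 < u ^ (2 * (N + 1) + 1) * exp u"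
      using True by simp
    ultimately have C: "C \<ge> 0"
      by (meson mult_neg_pos not_le)
    have "norm (r u) = ?e u * \<bar>g u - p u\<bar>"
      using True by (simp add: r_def abs_mult)
    also have "\<dots> \<le> ?e u * (C * (u ^ (2 * (N + 1) + 1) * exp u))"
      by (intro mult_left_mono le) simp
    also have "\<dots> = C * u ^ (2 * (N + 1) + 1) * (?e u * exp u)"
      by simp
    also have "\<dots> \<le> C * u ^ (2 * (N + 1) + 1) * (exp (- (u\<^sup>2 / (4 * T))) * exp T)"
      using C True by (intro mult_left_mono exp_le) auto
    also have "\<dots> = m u"
      using True by (simp add: m_def)
    finally show ?thesis .
  qed (simp add: r_def m_def)
  have [measurable]: "r \<in> borel_measurable lborel"
  proof -
    have [measurable]: "(\<lambda>u. ?i u *\<^sub>R g u) \<in> borel_measurable lborel"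
      using meas by (simp add: set_borel_measurable_def)
    have "r = (\<lambda>u. ?e u * (?i u *\<^sub>R g u) - ?i u *\<^sub>R (?e u * p u))"
      by (auto simp: r_def algebra_simps)
    moreover have "\<dots> \<in> borel_measurable lborel"
      unfolding p_def by measurable
    ultimately show ?thesis
      by simp
  qed
  have r: "integrable lborel r"
  proof (rule Bochner_Integration.integrable_bound[of lborel m r])
    show "AE u in lborel. norm (r u) \<le> norm (m u)"
      using order_trans[OF r_le abs_ge_self] by simp
  qed (use m in \<open>auto simp: has_bochner_integral_iff\<close>)
  have "(\<lambda>u. ?i u *\<^sub>R (?e u * g u)) = (\<lambda>u. ?i u *\<^sub>R (?e u * p u) + r u)"
    by (auto simp: r_def algebra_simps)
  then have "(LBINT u:{0<..}. ?e u * g u) =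
      (\<Sum>k\<le>N. c k * ((2 * T) ^ (k + 1) * fact k / 2)) + integral\<^sup>L lborel r"
    using p r by (simp add: set_lebesgue_integral_def has_bochner_integral_iff)
  moreover have "norm (integral\<^sup>L lborel r) \<le> integral\<^sup>L lborel m"
    using r_le m by (intro Bochner_Integration.integral_norm_bound_integral r) (auto simp: has_bochner_integral_iff)
  ultimately show ?thesis
    using m by (simp add: has_bochner_integral_iff)
qed

lemma asymp_power_series_watson:
  fixes g :: "real \<Rightarrow> real"
  assumes meas: "set_borel_measurable lborel {0<..} g"
    and remainder: "\<And>N. \<exists>C. \<forall>u>0.
      \<bar>g u - (\<Sum>k\<le>N. c k * u ^ (2 * k + 1))\<bar> \<le> C * (u ^ (2 * (N + 1) + 1) * exp u)"
  shows "asymp_power_series_at_right_0 (\<lambda>T. (LBINT u:{0<..}. exp (- (u\<^sup>2 / (2 * T))) * g u) / T)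
    (\<lambda>k. c k * 2 ^ k * fact k)"
  unfolding asymp_power_series_at_right_0_def
proof
  fix N
  let ?I = "\<lambda>T. LBINT u:{0<..}. exp (- (u\<^sup>2 / (2 * T))) * g u"
  obtain C where C: "\<And>u. u > 0 \<Longrightarrow>
      \<bar>g u - (\<Sum>k\<le>N. c k * u ^ (2 * k + 1))\<bar> \<le> C * (u ^ (2 * (N + 1) + 1) * exp u)"
    using remainder[of N] by auto
  have "0 \<le> C * (1 ^ (2 * (N + 1) + 1) * exp 1)"
    using order_trans[OF abs_ge_zero C[of 1]] by simp
  then have C0: "C \<ge> 0"
    by (simp add: zero_le_mult_iff)
  \<comment> \<open>For T < 1 the factor \<open>exp T\<close> is at most \<open>exp 1\<close>, and
    dividing by T lowers the power of T from N + 2 to N + 1.\<close>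
  define K where "K = C * exp 1 * (4 ^ (N + 2) * fact (N + 1) / 2)"
  have "norm (?I T / T - (\<Sum>k\<le>N. c k * 2 ^ k * fact k * T ^ k)) \<le> K * norm (T ^ (N + 1))"
    if T: "T > 0" "T < 1" for T
  proof -
    have "?I T / T - (\<Sum>k\<le>N. c k * 2 ^ k * fact k * T ^ k) =
        (?I T - (\<Sum>k\<le>N. c k * ((2 * T) ^ (k + 1) * fact k / 2))) / T"
      using T by (simp add: diff_divide_distrib sum_divide_distrib power_mult_distrib mult_ac)
    also have "norm \<dots> \<le> C * exp T * ((4 * T) ^ (N + 2) * fact (N + 1) / 2) / T"
      unfolding real_norm_def abs_divide abs_of_pos[OF T(1)]
      using T by (intro divide_right_mono watson_remainder[OF meas C]) auto
    also have "\<dots> = exp T * (C * (4 ^ (N + 2) * fact (N + 1) / 2) * T ^ (N + 1))"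
      using T by (simp add: power_mult_distrib)
    also have "\<dots> \<le> exp 1 * (C * (4 ^ (N + 2) * fact (N + 1) / 2) * T ^ (N + 1))"
      using T C0 by (intro mult_right_mono) auto
    also have "\<dots> = K * norm (T ^ (N + 1))"
      using T by (simp add: K_def)
    finally show ?thesis .
  qed
  then have "eventually (\<lambda>T. norm (?I T / T - (\<Sum>k\<le>N. c k * 2 ^ k * fact k * T ^ k)) \<le> K * norm (T ^ (N + 1)))
      (at_right 0)"
    by (auto simp: eventually_at_right_field intro!: exI[of _ 1])
  then show "(\<lambda>T. ?I T / T - (\<Sum>k\<le>N. c k * 2 ^ k * fact k * T ^ k)) \<in> O[at_right 0](\<lambda>T. T ^ (N + 1))"
    by (rule bigoI)
qed

text \<open>Factoring \<open>x ^ (N + 1)\<close> out of the tail leaves a series dominated, for all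
  x up to r, by its absolute value series at r; the sum of the latter is the constant.\<close>

lemma power_series_remainder:
  fixes c :: "nat \<Rightarrow> real"
  assumes r: "r > 0" and summ: "summable (\<lambda>k. \<bar>c k\<bar> * r ^ k)"
  obtains C where "\<And>x. 0 \<le> x \<Longrightarrow> x \<le> r \<Longrightarrow>
    \<bar>(\<Sum>k. c k * x ^ k) - (\<Sum>k\<le>N. c k * x ^ k)\<bar> \<le> C * x ^ (N + 1)"
proof
  define C where "C = (\<Sum>k. \<bar>c (k + (N + 1))\<bar> * r ^ k)"
  have "summable (\<lambda>k. \<bar>c (k + (N + 1))\<bar> * r ^ (k + (N + 1)) / r ^ (N + 1))"
    using summable_ignore_initial_segment[OF summ] by (rule summable_divide)
  then have sC: "summable (\<lambda>k. \<bar>c (k + (N + 1))\<bar> * r ^ k)"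
    using r by (simp add: power_add)
  fix x assume x: "0 \<le> x" "x \<le> r"
  have s0: "summable (\<lambda>k. c k * x ^ k)"
    by (rule summable_comparison_test'[OF summ, of 0])
       (use x in \<open>auto simp: abs_mult intro!: mult_left_mono power_mono\<close>)
  have sx: "summable (\<lambda>k. norm (c (k + (N + 1)) * x ^ k))"
    by (rule summable_comparison_test'[OF sC, of 0])
       (use x in \<open>auto simp: abs_mult intro!: mult_left_mono power_mono\<close>)
  have "(\<Sum>k. c k * x ^ k) - (\<Sum>k\<le>N. c k * x ^ k) = (\<Sum>k. c (k + (N + 1)) * x ^ (k + (N + 1)))"
    using suminf_split_initial_segment[OF s0, of "N + 1"] by (simp add: lessThan_Suc_atMost)
  also have "\<dots> = (\<Sum>k. c (k + (N + 1)) * x ^ k) * x ^ (N + 1)"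
    using suminf_mult2[OF summable_norm_cancel[OF sx], of "x ^ (N + 1)"] by (simp add: power_add mult_ac)
  finally have "\<bar>(\<Sum>k. c k * x ^ k) - (\<Sum>k\<le>N. c k * x ^ k)\<bar> = \<bar>\<Sum>k. c (k + (N + 1)) * x ^ k\<bar> * x ^ (N + 1)"
    using x by (simp add: abs_mult)
  also have "\<bar>\<Sum>k. c (k + (N + 1)) * x ^ k\<bar> \<le> C"
  proof -
    have "\<bar>\<Sum>k. c (k + (N + 1)) * x ^ k\<bar> \<le> (\<Sum>k. norm (c (k + (N + 1)) * x ^ k))"
      using summable_norm[OF sx] by simp
    also have "\<dots> \<le> C"
      unfolding C_def
      by (rule suminf_le[OF _ sx sC]) (use x in \<open>auto simp: abs_mult intro!: mult_left_mono power_mono\<close>)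
    finally show ?thesis .
  qed
  finally show "\<bar>(\<Sum>k. c k * x ^ k) - (\<Sum>k\<le>N. c k * x ^ k)\<bar> \<le> C * x ^ (N + 1)"
    using x by (simp add: mult_right_mono)
qed

section \<open>Calculus of asymptotic power series\<close>

lemma asymp_power_series_exp:
  "asymp_power_series_at_right_0 (\<lambda>T. exp (a * T)) (\<lambda>k. a ^ k / fact k)"
  unfolding asymp_power_series_at_right_0_def
proof
  fix N
  have "summable (\<lambda>k. \<bar>a ^ k / fact k\<bar> * 1 ^ k)"
    using summable_norm_exp[of a] by (simp add: divide_inverse mult.commute power_abs abs_mult)
  from power_series_remainder[OF _ this, of N] obtain C where C: "\<And>T. 0 \<le> T \<Longrightarrow> T \<le> 1 \<Longrightarrow>
      \<bar>(\<Sum>k. a ^ k / fact k * T ^ k) - (\<Sum>k\<le>N. a ^ k / fact k * T ^ k)\<bar> \<le> C * T ^ (N + 1)"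
    by auto
  have "exp (a * T) = (\<Sum>k. a ^ k / fact k * T ^ k)" for T
    unfolding exp_def by (simp add: power_mult_distrib divide_inverse mult_ac)
  with C have "norm (exp (a * T) - (\<Sum>k\<le>N. a ^ k / fact k * T ^ k)) \<le> C * norm (T ^ (N + 1))"
    if "T > 0" "T < 1" for T
    using that by simp
  then show "(\<lambda>T. exp (a * T) - (\<Sum>k\<le>N. a ^ k / fact k * T ^ k)) \<in> O[at_right 0](\<lambda>T. T ^ (N + 1))"
    by (intro bigoI[of _ C]) (auto simp: eventually_at_right_field intro!: exI[of _ 1])
qed

lemma asymp_power_series_mult:
  assumes f: "asymp_power_series_at_right_0 f a" and g: "asymp_power_series_at_right_0 g b"
  shows "asymp_power_series_at_right_0 (\<lambda>T. f T * g T) (\<lambda>k. \<Sum>i\<le>k. a i * b (k - i))"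
  unfolding asymp_power_series_at_right_0_def
proof
  fix N
  \<comment> \<open>The expansion of order 0 says that g differs from \<open>b 0\<close> by O(T),
    hence g is bounded near 0.\<close>
  have g_bdd: "g \<in> O[at_right 0](\<lambda>_. 1)"
  proof -
    have "(\<lambda>T :: real. T) \<in> O[at_right 0](\<lambda>_. 1)"
      by real_asymp
    then have "(\<lambda>T. g T - (\<Sum>k\<le>0. b k * T ^ k)) \<in> O[at_right 0](\<lambda>_. 1)"
      using g[unfolded asymp_power_series_at_right_0_def, rule_format, of 0]
      by (auto intro: landau_o.big_trans)
    from sum_in_bigo(1)[OF this, of "\<lambda>_. b 0"] show ?thesis
      by simp
  qed
  \<comment> \<open>Against \<open>a i * T ^ i\<close> the factor g is truncated at order N - i. The
    truncated products then add up to exactly the Cauchy product through order N, and each error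
    carries \<open>T ^ i\<close> times \<open>T ^ (N - i + 1)\<close>.\<close>
  have decomp: "f T * g T - (\<Sum>k\<le>N. (\<Sum>i\<le>k. a i * b (k - i)) * T ^ k) =
      (f T - (\<Sum>i\<le>N. a i * T ^ i)) * g T +
      (\<Sum>i\<le>N. a i * T ^ i * (g T - (\<Sum>j\<le>N - i. b j * T ^ j)))" for T
  proof -
    have "(\<Sum>i\<le>N. a i * T ^ i * (\<Sum>j\<le>N - i. b j * T ^ j)) =
        (\<Sum>(i, j)\<in>(SIGMA i:{..N}. {..N - i}). a i * T ^ i * (b j * T ^ j))"
      by (simp add: sum.Sigma sum_distrib_left)
    also have "(SIGMA i:{..N}. {..N - i}) = {(i, j). i + j \<le> N}"
      by auto
    also have "(\<Sum>(i, j)\<in>{(i, j). i + j \<le> N}. a i * T ^ i * (b j * T ^ j)) =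
        (\<Sum>k\<le>N. \<Sum>i\<le>k. a i * T ^ i * (b (k - i) * T ^ (k - i)))"
      by (rule sum.triangle_reindex_eq)
    also have "\<dots> = (\<Sum>k\<le>N. (\<Sum>i\<le>k. a i * b (k - i)) * T ^ k)"
    proof (intro sum.cong refl)
      fix k
      have "a i * T ^ i * (b (k - i) * T ^ (k - i)) = a i * b (k - i) * T ^ k" if "i \<le> k" for i
        using that power_add[of T i "k - i"] by simp
      then show "(\<Sum>i\<le>k. a i * T ^ i * (b (k - i) * T ^ (k - i))) = (\<Sum>i\<le>k. a i * b (k - i)) * T ^ k"
        unfolding sum_distrib_right by (intro sum.cong refl) (simp only: atMost_iff)
    qed
    finally show ?thesis
      by (simp add: algebra_simps sum_subtractf sum_distrib_left sum_distrib_right)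
  qed
  have "(\<lambda>T. (f T - (\<Sum>i\<le>N. a i * T ^ i)) * g T) \<in> O[at_right 0](\<lambda>T. T ^ (N + 1) * 1)"
    using f g_bdd unfolding asymp_power_series_at_right_0_def by (intro landau_o.big.mult) auto
  moreover have "(\<lambda>T. a i * T ^ i * (g T - (\<Sum>j\<le>N - i. b j * T ^ j))) \<in> O[at_right 0](\<lambda>T. T ^ (N + 1))"
    if "i \<le> N" for i
  proof -
    have "(\<lambda>T. a i * T ^ i * (g T - (\<Sum>j\<le>N - i. b j * T ^ j))) \<in> O[at_right 0](\<lambda>T. T ^ i * T ^ (N - i + 1))"
      using g unfolding asymp_power_series_at_right_0_def by (intro landau_o.big.mult) auto
    moreover have "T ^ i * T ^ (N - i + 1) = T ^ (N + 1)" for T :: real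
      using that by (simp only: power_add [symmetric]) simp
    ultimately show ?thesis
      by (simp only:)
  qed
  ultimately show "(\<lambda>T. f T * g T - (\<Sum>k\<le>N. (\<Sum>i\<le>k. a i * b (k - i)) * T ^ k)) \<in> O[at_right 0](\<lambda>T. T ^ (N + 1))"
    unfolding decomp by (intro sum_in_bigo(1) big_sum_in_bigo) auto
qed

lemma asymp_power_series_cmult:
  assumes "asymp_power_series_at_right_0 f a"
  shows "asymp_power_series_at_right_0 (\<lambda>T. C * f T) (\<lambda>k. C * a k)"
  unfolding asymp_power_series_at_right_0_def
proof
  fix N
  have "(\<lambda>T. C * (f T - (\<Sum>k\<le>N. a k * T ^ k))) \<in> O[at_right 0](\<lambda>T. T ^ (N + 1))"
    using assms unfolding asymp_power_series_at_right_0_def by simp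
  then show "(\<lambda>T. C * f T - (\<Sum>k\<le>N. C * a k * T ^ k)) \<in> O[at_right 0](\<lambda>T. T ^ (N + 1))"
    by (simp add: right_diff_distrib sum_distrib_left mult.assoc)
qed

lemma asymp_power_series_cong:
  assumes "\<And>T. T > 0 \<Longrightarrow> f T = g T" and "asymp_power_series_at_right_0 g a"
  shows "asymp_power_series_at_right_0 f a"
  unfolding asymp_power_series_at_right_0_def
proof
  fix N
  have "eventually (\<lambda>T. f T - (\<Sum>k\<le>N. a k * T ^ k) = g T - (\<Sum>k\<le>N. a k * T ^ k)) (at_right 0)"
    using eventually_at_right_less[of "0 :: real"] by eventually_elim (simp add: assms(1))
  from landau_o.big.in_cong[OF this] show "(\<lambda>T. f T - (\<Sum>k\<le>N. a k * T ^ k)) \<in> O[at_right 0](\<lambda>T. T ^ (N + 1))"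
    using assms(2) unfolding asymp_power_series_at_right_0_def by simp
qed

section \<open>The power series of g at the origin\<close>

lemma holomorphic_on_sinh:
  assumes "f holomorphic_on A"
  shows "(\<lambda>z. sinh (f z :: complex)) holomorphic_on A"
  unfolding sinh_field_def using assms by (intro holomorphic_intros) auto

lemma holomorphic_sabr_g_complex:
  assumes "\<And>z. z \<in> A \<Longrightarrow> norm (sinh (z / 2)) < 1"
  shows "sabr_g_complex a holomorphic_on A"
  unfolding sabr_g_complex_def using assms
  by (intro holomorphic_intros holomorphic_on_sinh holomorphic_on_compose_gen[OF _ holomorphic_sabr_theta_integral, unfolded o_def])
     auto

text \<open>The Taylor series of the continuation at 0 converges on a ball on which
  \<open>sinh (z / 2)\<close> stays in the unit ball. Real parts are taken because g is real on the
  real axis, and oddness removes the even terms.\<close>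

lemma sabr_g_power_series:
  obtains c r where "r > 0" "summable (\<lambda>k. \<bar>c k\<bar> * (r\<^sup>2) ^ k)"
    "\<And>u. 0 < u \<Longrightarrow> u \<le> r \<Longrightarrow> (\<lambda>k. c k * u ^ (2 * k + 1)) sums sabr_g \<sigma> u"
proof -
  let ?f = "sabr_g_complex (\<sigma> / 2)"
  have "open {z :: complex. norm (sinh (z / 2)) < 1}"
    by (intro open_Collect_less continuous_intros) auto
  then obtain \<rho> where \<rho>: "\<rho> > 0" "ball 0 \<rho> \<subseteq> {z :: complex. norm (sinh (z / 2)) < 1}"
    by (metis (no_types, lifting) mem_Collect_eq openE div_0 norm_zero sinh_0 zero_less_one)
  then have hol: "?f holomorphic_on ball 0 \<rho>"
    by (intro holomorphic_sabr_g_complex) auto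
  define d where "d n = (deriv ^^ n) ?f 0 / fact n" for n
  have d: "(\<lambda>n. d n * z ^ n) sums ?f z" if "norm z < \<rho>" for z
    using holomorphic_power_series[OF hol, of z] that unfolding d_def by simp
  define c where "c k = Re (d (2 * k + 1))" for k
  have c: "(\<lambda>k. c k * u ^ (2 * k + 1)) sums sabr_g \<sigma> u" if u: "0 < u" "u < \<rho>" for u
  proof -
    have pos: "(\<lambda>n. Re (d n) * u ^ n) sums sabr_g \<sigma> u"
      using sums_Re[OF d[of "of_real u"]] u by (simp add: sabr_g_complex_of_real flip: of_real_power)
    have "sabr_g_complex (\<sigma> / 2) (of_real (- u)) = of_real (- sabr_g \<sigma> u)"
      using u by (simp add: sabr_g_complex_uminus sabr_g_complex_of_real)
    then have neg: "(\<lambda>n. Re (d n) * (- u) ^ n) sums (- sabr_g \<sigma> u)"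
      using sums_Re[OF d[of "of_real (- u)"]] u by (simp flip: of_real_power of_real_minus)
    \<comment> \<open>Half the difference of the series at u and at -u keeps exactly the odd terms,
      without computing the even coefficients.\<close>
    have "(\<lambda>n. (Re (d n) * u ^ n - Re (d n) * (- u) ^ n) / 2) sums ((sabr_g \<sigma> u - - sabr_g \<sigma> u) / 2)"
      by (intro sums_divide sums_diff pos neg)
    moreover have "(\<lambda>n. (Re (d n) * u ^ n - Re (d n) * (- u) ^ n) / 2) =
        (\<lambda>n. if odd n then Re (d n) * u ^ n else 0)"
      by auto
    ultimately have "(\<lambda>n. if odd n then Re (d n) * u ^ n else 0) sums sabr_g \<sigma> u"
      by simp
    moreover have "strict_mono (\<lambda>k :: nat. 2 * k + 1)"
      by (auto intro: strict_monoI)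
    ultimately have "(\<lambda>k. if odd (2 * k + 1) then Re (d (2 * k + 1)) * u ^ (2 * k + 1) else 0) sums sabr_g \<sigma> u"
      by (subst sums_mono_reindex[where f = "\<lambda>n. if odd n then Re (d n) * u ^ n else 0"])
         (auto elim!: oddE)
    then show ?thesis
      by (simp add: c_def)
  qed
  \<comment> \<open>Convergence at \<open>2 * \<rho> / 3\<close>, strictly between
    \<open>\<rho> / 2\<close> and \<open>\<rho>\<close>, yields absolute convergence at
    \<open>\<rho> / 2\<close>.\<close>
  have "summable (\<lambda>k. c k * ((2 * \<rho> / 3)\<^sup>2) ^ k)"
  proof -
    have "summable (\<lambda>k. c k * (2 * \<rho> / 3) ^ (2 * k + 1) / (2 * \<rho> / 3))"
      by (intro summable_divide sums_summable[OF c]) (use \<rho> in auto)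
    then show ?thesis
      using \<rho> by (simp add: power_mult)
  qed
  moreover have "norm ((\<rho> / 2)\<^sup>2) < norm ((2 * \<rho> / 3)\<^sup>2)"
    using \<rho> by (simp add: power2_eq_square)
  ultimately have "summable (\<lambda>k. norm (c k * ((\<rho> / 2)\<^sup>2) ^ k))"
    by (rule powser_insidea)
  then have "summable (\<lambda>k. \<bar>c k\<bar> * ((\<rho> / 2)\<^sup>2) ^ k)"
    by (simp add: abs_mult)
  then show ?thesis
    using that[of "\<rho> / 2" c] c \<rho> by auto
qed

text \<open>Watson's lemma needs the Taylor error on the whole half-line, while the series is only
  controlled up to r. Up to r the power series remainder in \<open>u\<^sup>2\<close> suffices;
  beyond r both g and the polynomial are crudely bounded by multiples of
  \<open>u ^ m * exp u\<close>.\<close>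

lemma odd_power_series_global_remainder:
  fixes g :: "real \<Rightarrow> real"
  assumes r: "r > 0" and summ: "summable (\<lambda>k. \<bar>c k\<bar> * (r\<^sup>2) ^ k)"
    and sums: "\<And>u. 0 < u \<Longrightarrow> u \<le> r \<Longrightarrow> (\<lambda>k. c k * u ^ (2 * k + 1)) sums g u"
    and growth: "\<And>u. u > 0 \<Longrightarrow> \<bar>g u\<bar> \<le> B * exp u"
  shows "\<exists>C. \<forall>u>0. \<bar>g u - (\<Sum>k\<le>N. c k * u ^ (2 * k + 1))\<bar> \<le> C * (u ^ (2 * (N + 1) + 1) * exp u)"
proof -
  obtain C1 where C1: "\<And>x. 0 \<le> x \<Longrightarrow> x \<le> r\<^sup>2 \<Longrightarrow>
      \<bar>(\<Sum>k. c k * x ^ k) - (\<Sum>k\<le>N. c k * x ^ k)\<bar> \<le> C1 * x ^ (N + 1)"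
    using power_series_remainder[of "r\<^sup>2" c N] r summ by auto
  define m where "m = 2 * (N + 1) + 1"
  define C2 where "C2 = B / r ^ m + (\<Sum>k\<le>N. \<bar>c k\<bar> * r ^ (2 * k + 1) / r ^ m)"
  have "B * exp 1 \<ge> 0"
    using growth[of 1] by (rule order_trans[OF abs_ge_zero]) simp
  then have B: "B \<ge> 0"
    by (simp add: zero_le_mult_iff)
  have near: "\<bar>g u - (\<Sum>k\<le>N. c k * u ^ (2 * k + 1))\<bar> \<le> C1 * u ^ m" if u: "0 < u" "u \<le> r" for u
  proof -
    have su: "(\<lambda>k. c k * (u\<^sup>2) ^ k * u) sums g u"
      using sums[OF u] by (simp only: power_add power_mult power_one_right mult.assoc)
    from sums_divide[OF this, of u] have "(\<lambda>k. c k * (u\<^sup>2) ^ k) sums (g u / u)"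
      using u by simp
    then have "g u = (\<Sum>k. c k * (u\<^sup>2) ^ k) * u"
      using u by (simp add: sums_iff)
    moreover have "(\<Sum>k\<le>N. c k * u ^ (2 * k + 1)) = (\<Sum>k\<le>N. c k * (u\<^sup>2) ^ k) * u"
      by (simp only: sum_distrib_right power_add power_mult power_one_right mult.assoc)
    ultimately have "g u - (\<Sum>k\<le>N. c k * u ^ (2 * k + 1)) =
        ((\<Sum>k. c k * (u\<^sup>2) ^ k) - (\<Sum>k\<le>N. c k * (u\<^sup>2) ^ k)) * u"
      by (simp only: left_diff_distrib)
    also have "\<bar>\<dots>\<bar> \<le> C1 * (u\<^sup>2) ^ (N + 1) * u"
      using C1[of "u\<^sup>2"] u by (simp only: abs_mult abs_of_pos) (intro mult_right_mono; simp add: power_mono)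
    also have "\<dots> = C1 * u ^ m"
      by (simp only: m_def power_add power_mult power_one_right mult.assoc)
    finally show ?thesis .
  qed
  have far: "\<bar>g u - (\<Sum>k\<le>N. c k * u ^ (2 * k + 1))\<bar> \<le> C2 * (u ^ m * exp u)" if u: "u \<ge> r" for u
  proof -
    have "u > 0" "exp u \<ge> 1"
      using u r by auto
    \<comment> \<open>Since \<open>r / u \<le> 1\<close>, a lower power of u is at most a constant
      multiple of \<open>u ^ m\<close>.\<close>
    have pow: "u ^ j \<le> r ^ j / r ^ m * u ^ m" if "j \<le> m" for j
    proof -
      have "(r / u) ^ m \<le> (r / u) ^ j"
        using u r \<open>u > 0\<close> that by (intro power_decreasing) auto
      then show ?thesis
        using r \<open>u > 0\<close> by (simp add: field_simps)
    qed
    have "\<bar>g u\<bar> \<le> B * exp u * 1"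
      using growth[OF \<open>u > 0\<close>] by simp
    also have "\<dots> \<le> B * exp u * (u ^ m / r ^ m)"
      using pow[of 0] B by (intro mult_left_mono) auto
    finally have "\<bar>g u\<bar> \<le> B / r ^ m * (u ^ m * exp u)"
      by (simp add: mult_ac)
    moreover have "\<bar>\<Sum>k\<le>N. c k * u ^ (2 * k + 1)\<bar> \<le> (\<Sum>k\<le>N. \<bar>c k\<bar> * r ^ (2 * k + 1) / r ^ m) * (u ^ m * exp u)"
    proof -
      have "\<bar>\<Sum>k\<le>N. c k * u ^ (2 * k + 1)\<bar> \<le> (\<Sum>k\<le>N. \<bar>c k * u ^ (2 * k + 1)\<bar>)"
        by (rule sum_abs)
      also have "\<dots> \<le> (\<Sum>k\<le>N. \<bar>c k\<bar> * r ^ (2 * k + 1) / r ^ m * (u ^ m * exp u))"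
      proof (rule sum_mono)
        fix k assume "k \<in> {..N}"
        then have "\<bar>c k * u ^ (2 * k + 1)\<bar> \<le> \<bar>c k\<bar> * (r ^ (2 * k + 1) / r ^ m * u ^ m)"
          using pow[of "2 * k + 1"] \<open>u > 0\<close> unfolding abs_mult m_def
          by (intro mult_left_mono) auto
        also have "\<dots> \<le> \<bar>c k\<bar> * (r ^ (2 * k + 1) / r ^ m * u ^ m) * exp u"
          using \<open>exp u \<ge> 1\<close> \<open>u > 0\<close> r mult_left_mono[OF \<open>exp u \<ge> 1\<close>, of "\<bar>c k\<bar> * (r ^ (2 * k + 1) / r ^ m * u ^ m)"]
          by simp
        finally show "\<bar>c k * u ^ (2 * k + 1)\<bar> \<le> \<bar>c k\<bar> * r ^ (2 * k + 1) / r ^ m * (u ^ m * exp u)"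
          by (simp add: mult_ac)
      qed
      finally show ?thesis
        by (simp only: sum_distrib_right)
    qed
    ultimately show ?thesis
      unfolding C2_def distrib_right by linarith
  qed
  have "\<bar>g u - (\<Sum>k\<le>N. c k * u ^ (2 * k + 1))\<bar> \<le> max \<bar>C1\<bar> C2 * (u ^ m * exp u)" if u: "u > 0" for u
  proof (cases "u \<le> r")
    case True
    have "C1 * u ^ m \<le> \<bar>C1\<bar> * (u ^ m * exp u)"
      using u by (intro mult_mono) auto
    also have "\<dots> \<le> max \<bar>C1\<bar> C2 * (u ^ m * exp u)"
      using u by (intro mult_right_mono) auto
    finally show ?thesis
      using near[OF u True] by linarith
  next
    case False
    have "C2 * (u ^ m * exp u) \<le> max \<bar>C1\<bar> C2 * (u ^ m * exp u)"
      using u by (intro mult_right_mono) auto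
    then show ?thesis
      using far[of u] False by linarith
  qed
  then show ?thesis
    unfolding m_def by blast
qed

section \<open>The singularity at i pi\<close>

text \<open>\<open>sin x = 2 sin (x/2) cos (x/2)\<close> is at least
  \<open>x (cos (x/2))\<^sup>2\<close> because \<open>t cos t \<le> sin t\<close>, and on this range
  the squared cosine is at least 1/2.\<close>

lemma half_self_le_sin:
  assumes "0 \<le> x" "x \<le> pi / 2"
  shows "x / 2 \<le> sin x"
proof -
  have "x / 2 * cos (x / 2) \<le> sin (x / 2)"
  proof -
    have "(\<lambda>t. sin t - t * cos t) 0 \<le> (\<lambda>t. sin t - t * cos t) (x / 2)"
    proof (rule DERIV_nonneg_imp_nondecreasing[of 0 "x / 2" "\<lambda>t. sin t - t * cos t"])
      fix t assume t: "0 \<le> t" "t \<le> x / 2"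
      have "((\<lambda>t. sin t - t * cos t) has_real_derivative t * sin t) (at t)"
        by (auto intro!: derivative_eq_intros)
      moreover have "0 \<le> t * sin t"
        using t assms by (intro mult_nonneg_nonneg sin_ge_zero) auto
      ultimately show "\<exists>y. ((\<lambda>t. sin t - t * cos t) has_real_derivative y) (at t) \<and> 0 \<le> y"
        by blast
    qed (use assms in auto)
    then show ?thesis
      by simp
  qed
  moreover have c: "cos (x / 2) \<ge> sqrt 2 / 2"
    using cos_monotone_0_pi_le[of "x / 2" "pi / 4"] assms by (simp add: cos_45)
  ultimately have "2 * (x / 2 * cos (x / 2)) * cos (x / 2) \<le> 2 * sin (x / 2) * cos (x / 2)"
    by (intro mult_right_mono mult_left_mono) (use order_trans[OF _ c, of 0] in auto)
  moreover have "(sqrt 2 / 2)\<^sup>2 \<le> (cos (x / 2))\<^sup>2"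
    using c by (intro power_mono) auto
  then have "x * (1 / 2) \<le> x * (cos (x / 2))\<^sup>2"
    using assms by (intro mult_left_mono) (auto simp: power_divide)
  ultimately show ?thesis
    using sin_double[of "x / 2"] by (simp add: power2_eq_square)
qed

text \<open>Comparison integral whose value grows like a logarithm as d tends to 0.\<close>

lemma has_integral_inverse_affine:
  assumes "d > 0" "b > 0"
  shows "((\<lambda>\<theta>. 1 / (d + b * (pi / 2 - \<theta>))) has_integral ln ((d + b * (pi / 2)) / d) / b) {0..pi/2}"
proof -
  have pos: "0 < d + b * (pi / 2 - \<theta>)" if "\<theta> \<in> {0..pi/2}" for \<theta>
    using assms that by (intro add_pos_nonneg) auto
  have "((\<lambda>\<theta>. 1 / (d + b * (pi / 2 - \<theta>))) has_integral
      - ln (d + b * (pi / 2 - pi / 2)) / b - - ln (d + b * (pi / 2 - 0)) / b) {0..pi/2}"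
  proof (rule fundamental_theorem_of_calculus)
    fix \<theta> assume "\<theta> \<in> {0..pi/2}"
    then have "((\<lambda>\<theta>. - ln (d + b * (pi / 2 - \<theta>)) / b) has_real_derivative 1 / (d + b * (pi / 2 - \<theta>)))
        (at \<theta> within {0..pi/2})"
      using pos[of \<theta>] assms by (auto intro!: derivative_eq_intros simp: inverse_eq_divide)
    then show "((\<lambda>\<theta>. - ln (d + b * (pi / 2 - \<theta>)) / b) has_vector_derivative 1 / (d + b * (pi / 2 - \<theta>)))
        (at \<theta> within {0..pi/2})"
      by (simp add: has_real_derivative_iff_has_vector_derivative)
  qed auto
  moreover have "ln ((d + b * (pi / 2)) / d) = ln (d + b * (pi / 2)) - ln d"
    using pos[of 0] assms by (subst ln_div) auto
  ultimately show ?thesis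
    by (simp add: diff_divide_distrib)
qed

text \<open>Both bounds grow like ln (1 / \<epsilon>). The kernel has the order of 1 / D with
  \<open>D = sqrt (1 - (cos \<epsilon> * sin \<theta>)\<^sup>2)\<close>, and D is comparable to
  \<open>sin \<epsilon> + (pi / 2 - \<theta>)\<close>, so the integral is squeezed between two
  logarithmic comparison integrals.\<close>

lemma sabr_theta_integral_imaginary:
  assumes a: "a > 0" and \<epsilon>: "0 < \<epsilon>" "\<epsilon> < pi / 2"
  obtains K where "sabr_theta_integral a (\<i> * of_real (cos \<epsilon>)) = of_real K"
    "a * ln ((sin \<epsilon> + pi / 2) / sin \<epsilon>) \<le> K"
    "K \<le> 4 * a * cosh a * ln ((sin \<epsilon> + pi / 4) / sin \<epsilon>)"
proof -
  define \<rho> \<delta> where "\<rho> = cos \<epsilon>" and "\<delta> = sin \<epsilon>"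
  have \<rho>: "0 < \<rho>" "\<rho> < 1"
    using \<epsilon> cos_monotone_0_pi[of 0 \<epsilon>] by (auto simp: \<rho>_def intro!: cos_gt_zero)
  have \<delta>: "\<delta> > 0" "\<delta>\<^sup>2 = 1 - \<rho>\<^sup>2"
    using \<epsilon> by (auto simp: \<delta>_def \<rho>_def sin_squared_eq intro!: sin_gt_zero)
  define k where "k \<theta> = Re (sabr_kernel a (\<i> * of_real \<rho> * of_real (sin \<theta>)))" for \<theta>
  have k: "sabr_kernel a (\<i> * of_real \<rho> * of_real (sin \<theta>)) = of_real (k \<theta>) \<and>
      a * (1 / (\<delta> + 1 * (pi / 2 - \<theta>))) \<le> k \<theta> \<and>
      k \<theta> \<le> 2 * a * cosh a * (1 / (\<delta> + 1 / 2 * (pi / 2 - \<theta>)))"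
    if \<theta>: "\<theta> \<in> {0..pi/2}" for \<theta>
  proof -
    define x where "x = pi / 2 - \<theta>"
    have x: "0 \<le> x" "x \<le> pi / 2"
      using \<theta> by (auto simp: x_def)
    have s: "0 \<le> sin \<theta>" "sin \<theta> \<le> 1"
      using \<theta> by (auto intro!: sin_ge_zero)
    then have r: "0 \<le> \<rho> * sin \<theta>" "\<rho> * sin \<theta> < 1"
      using \<rho> mult_left_mono[of "sin \<theta>" 1 \<rho>] by (simp, linarith)
    obtain \<kappa> where \<kappa>: "a \<le> \<kappa>" "\<kappa> \<le> a * cosh a"
      "sabr_kernel a (\<i> * of_real (\<rho> * sin \<theta>)) = of_real (\<kappa> / sqrt (1 - (\<rho> * sin \<theta>)\<^sup>2))"
      using sabr_kernel_imaginary[OF a r] .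
    define D where "D = sqrt (1 - (\<rho> * sin \<theta>)\<^sup>2)"
    have k_eq: "k \<theta> = \<kappa> / D"
      using \<kappa>(3) by (simp add: k_def D_def mult_ac)
    have cos_eq: "cos \<theta> = sin x"
      by (simp add: x_def sin_diff)
    have cos_nonneg: "0 \<le> cos \<theta>"
      using x unfolding cos_eq by (intro sin_ge_zero) auto
    \<comment> \<open>Two forms of the same quantity: this one gives the upper bound for D and
      \<open>D \<ge> cos \<theta>\<close>, the next one gives
      \<open>D \<ge> \<delta>\<close>.\<close>
    have D1: "1 - (\<rho> * sin \<theta>)\<^sup>2 = (cos \<theta>)\<^sup>2 + (\<delta> * sin \<theta>)\<^sup>2"
      unfolding power_mult_distrib \<delta>(2) by (simp add: cos_squared_eq algebra_simps)
    have D2: "1 - (\<rho> * sin \<theta>)\<^sup>2 = \<delta>\<^sup>2 + (\<rho> * cos \<theta>)\<^sup>2"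
      unfolding power_mult_distrib \<delta>(2) by (simp add: cos_squared_eq algebra_simps)
    have "D \<ge> cos \<theta>"
      unfolding D_def D1 by (rule real_le_rsqrt) simp
    moreover have "D \<ge> \<delta>"
      unfolding D_def D2 by (rule real_le_rsqrt) simp
    moreover have "cos \<theta> \<ge> x / 2"
      unfolding cos_eq by (rule half_self_le_sin[OF x])
    \<comment> \<open>D dominates both \<open>\<delta>\<close> and x / 2, hence also their
      mean.\<close>
    ultimately have lower: "(\<delta> + 1 / 2 * x) / 2 \<le> D"
      by (simp add: field_simps)
    have "D \<le> cos \<theta> + \<delta> * sin \<theta>"
      unfolding D_def D1 using cos_nonneg \<delta> s by (intro sqrt_sum_squares_le_sum) auto
    also have "\<dots> \<le> x + \<delta>"
    proof (rule add_mono)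
      show "cos \<theta> \<le> x"
        unfolding cos_eq by (rule sin_x_le_x[OF x(1)])
      show "\<delta> * sin \<theta> \<le> \<delta>"
        using mult_left_mono[of "sin \<theta>" 1 \<delta>] \<delta>(1) s by simp
    qed
    finally have upper: "D \<le> \<delta> + 1 * x"
      by simp
    have D: "D > 0"
      using \<open>D \<ge> \<delta>\<close> \<delta> by linarith
    have "a * (1 / (\<delta> + 1 * x)) \<le> \<kappa> / D"
      unfolding times_divide_eq_right mult_1_right using a \<kappa> D upper by (intro frac_le) auto
    moreover have "\<kappa> / D \<le> (a * cosh a) / ((\<delta> + 1 / 2 * x) / 2)"
      using a \<kappa> \<delta> x lower by (intro frac_le) auto
    ultimately show ?thesis
      using \<kappa>(3) unfolding k_eq x_def [symmetric] D_def [symmetric] by (simp add: mult_ac)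
  qed
  have "\<i> * of_real \<rho> \<in> ball (0 :: complex) 1"
    using \<rho> by (simp add: norm_mult)
  then have "continuous_on {0..pi/2} k"
    unfolding k_def using mult_of_real_sin_in_ball[of "\<i> * of_real \<rho>"]
    by (intro continuous_on_Re continuous_on_compose2[OF holomorphic_on_imp_continuous_on[OF holomorphic_sabr_kernel]]
          continuous_intros) auto
  then have int: "k integrable_on {0..pi/2}"
    by (rule integrable_continuous_real)
  define K where "K = integral {0..pi/2} k"
  have "(k has_integral K) {0..pi/2}"
    unfolding K_def using int by (rule integrable_integral)
  from has_integral_of_real[OF this, where ?'b = complex]
  have "((\<lambda>\<theta>. sabr_kernel a (\<i> * of_real \<rho> * of_real (sin \<theta>))) has_integral of_real K) {0..pi/2}"
    by (rule has_integral_eq[rotated]) (use k in auto)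
  then have "sabr_theta_integral a (\<i> * of_real \<rho>) = of_real K"
    unfolding sabr_theta_integral_def by (rule integral_unique)
  moreover have "a * (ln ((\<delta> + 1 * (pi / 2)) / \<delta>) / 1) \<le> K"
    using has_integral_mult_right[OF has_integral_inverse_affine[OF \<delta>(1), of 1], of a] \<open>(k has_integral K) {0..pi/2}\<close>
    by (rule has_integral_le) (use k in auto)
  \<comment> \<open>The constant 4 combines the mean in \<open>lower\<close> with the slope 1/2 of
    the comparison integrand.\<close>
  moreover have "K \<le> 2 * a * cosh a * (ln ((\<delta> + 1 / 2 * (pi / 2)) / \<delta>) / (1 / 2))"
    using \<open>(k has_integral K) {0..pi/2}\<close>
      has_integral_mult_right[OF has_integral_inverse_affine[OF \<delta>(1), of "1 / 2"], of "2 * a * cosh a"]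
    by (rule has_integral_le) (use k in auto)
  ultimately show ?thesis
    using that[of K] by (simp add: \<rho>_def \<delta>_def mult_ac)
qed

section \<open>Continuation along the imaginary axis up to i pi\<close>

lemma norm_sinh_half_less_1_iff: "norm (sinh (z / 2)) < 1 \<longleftrightarrow> cosh (Re z) - cos (Im z) < 2"
proof -
  have "(norm (sinh (z / 2)))\<^sup>2 = (norm (sin (\<i> * (z / 2))))\<^sup>2"
    by (simp add: sinh_conv_sin norm_mult)
  also have "\<dots> = (cosh (Re z) - cos (Im z)) / 2"
    unfolding norm_sin_squared by (simp add: cosh_def exp_minus field_simps)
  finally have "(norm (sinh (z / 2)))\<^sup>2 = (cosh (Re z) - cos (Im z)) / 2" .
  moreover have "norm (sinh (z / 2)) < 1 \<longleftrightarrow> (norm (sinh (z / 2)))\<^sup>2 < 1"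
    by (simp add: power_less_one_iff)
  ultimately show ?thesis
    by (simp only:) simp
qed

text \<open>Shrinking z towards 0 lowers \<open>cosh (Re z)\<close> and, for
  \<open>\<bar>Im z\<bar> < pi\<close>, raises \<open>cos (Im z)\<close>, so the condition persists
  on the segment. The strip singles out one period of the cosine; starlikeness gives the
  connectedness that the identity theorem needs.\<close>

lemma starlike_sinh_half_less_1: "starlike {z :: complex. \<bar>Im z\<bar> < pi \<and> norm (sinh (z / 2)) < 1}"
  unfolding starlike_def
proof (intro bexI[of _ 0] ballI subsetI)
  fix z w :: complex
  assume z: "z \<in> {z. \<bar>Im z\<bar> < pi \<and> norm (sinh (z / 2)) < 1}" and "w \<in> closed_segment 0 z"
  then obtain t where t: "0 \<le> t" "t \<le> 1" "w = t *\<^sub>R z"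
    by (auto simp: closed_segment_def)
  have shrink: "\<bar>t * x\<bar> \<le> \<bar>x\<bar>" for x
    using t by (simp add: abs_mult mult_left_le_one_le)
  have "cosh \<bar>Re w\<bar> \<le> cosh \<bar>Re z\<bar>"
    using shrink t by (subst cosh_real_nonneg_le_iff) auto
  moreover have "cos \<bar>Im z\<bar> \<le> cos \<bar>Im w\<bar>"
    using shrink[of "Im z"] t z by (intro cos_monotone_0_pi_le) auto
  ultimately show "w \<in> {z. \<bar>Im z\<bar> < pi \<and> norm (sinh (z / 2)) < 1}"
    using z shrink[of "Im z"] t unfolding norm_sinh_half_less_1_iff by (auto simp: abs_if split: if_splits)
qed auto

text \<open>The point i pi is a boundary point of the connected domain D on which P must equal the
  continuation of g. Near it the size of P is of exact order \<epsilon> ln (1 / \<epsilon>): the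
  upper bound gives a zero at i pi, the lower bound an infinite difference quotient.\<close>

lemma sabr_g_no_entire_extension:
  assumes P: "P holomorphic_on UNIV" and r: "r > 0" and \<sigma>: "\<sigma> > 0"
    and eq: "\<And>u. 0 < u \<Longrightarrow> u < r \<Longrightarrow> P (of_real u) = of_real (sabr_g \<sigma> u)"
  shows False
proof -
  define a where "a = \<sigma> / 2"
  have a: "a > 0"
    using \<sigma> by (simp add: a_def)
  define D where "D = {z :: complex. \<bar>Im z\<bar> < pi \<and> norm (sinh (z / 2)) < 1}"
  have "open D"
    unfolding D_def by (intro open_Collect_conj open_Collect_less continuous_intros) auto
  moreover have "0 \<in> D"
    by (simp add: D_def)
  ultimately obtain e where e: "e > 0" "ball 0 e \<subseteq> D"
    by (meson openE)
  \<comment> \<open>A real segment accumulating at 0 on which both functions equal g, as the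
    identity theorem requires.\<close>
  define U where "U = complex_of_real ` {0<..<min e r}"
  have "0 islimpt U"
    unfolding islimpt_approachable
  proof (intro allI impI)
    fix d :: real assume "d > 0"
    then show "\<exists>x'\<in>U. x' \<noteq> 0 \<and> dist x' 0 < d"
      using e r unfolding U_def
      by (intro bexI[of _ "of_real (min d (min e r) / 2)"] imageI) auto
  qed
  have P_eq: "P z = sabr_g_complex a z" if "z \<in> D" for z
  proof -
    have "P z - sabr_g_complex a z = 0"
    proof (rule analytic_continuation[where S = D and U = U and \<xi> = 0 and f = "\<lambda>z. P z - sabr_g_complex a z"])
      show "(\<lambda>z. P z - sabr_g_complex a z) holomorphic_on D"
        by (intro holomorphic_intros holomorphic_sabr_g_complex holomorphic_on_subset[OF P]) (auto simp: D_def)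
      show "connected D"
        unfolding D_def by (rule starlike_imp_connected[OF starlike_sinh_half_less_1])
      show "U \<subseteq> D"
        using e by (force simp: U_def)
    next
      fix z assume "z \<in> U"
      then show "P z - sabr_g_complex a z = 0"
        by (auto simp: U_def a_def eq sabr_g_complex_of_real)
    qed fact+
    then show ?thesis
      by simp
  qed
  \<comment> \<open>The distance 2 \<epsilon> from i pi is chosen so that
    \<open>sinh (z / 2) = \<i> * cos \<epsilon>\<close>, the form treated above, and
    \<open>sinh z = \<i> * sin (2 * \<epsilon>)\<close>.\<close>
  define q where "q \<epsilon> = P (\<i> * of_real (pi - 2 * \<epsilon>))" for \<epsilon>
  have q: "sqrt 2 * sin (2 * \<epsilon>) * (a * ln ((sin \<epsilon> + pi / 2) / sin \<epsilon>)) \<le> norm (q \<epsilon>) \<and>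
      norm (q \<epsilon>) \<le> sqrt 2 * sin (2 * \<epsilon>) * (4 * a * cosh a * ln ((sin \<epsilon> + pi / 4) / sin \<epsilon>))"
    if \<epsilon>: "0 < \<epsilon>" "\<epsilon> < pi / 2" for \<epsilon>
  proof -
    obtain K where K: "sabr_theta_integral a (\<i> * of_real (cos \<epsilon>)) = of_real K"
      "a * ln ((sin \<epsilon> + pi / 2) / sin \<epsilon>) \<le> K" "K \<le> 4 * a * cosh a * ln ((sin \<epsilon> + pi / 4) / sin \<epsilon>)"
      using sabr_theta_integral_imaginary[OF a \<epsilon>] .
    have s: "0 < sin \<epsilon>" "0 < sin (2 * \<epsilon>)"
      using \<epsilon> by (auto intro!: sin_gt_zero)
    have "0 \<le> a * ln ((sin \<epsilon> + pi / 2) / sin \<epsilon>)"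
      using s a by (intro mult_nonneg_nonneg ln_ge_zero) auto
    then have "K \<ge> 0"
      using K by linarith
    have sinh_i: "sinh (\<i> * of_real y) = \<i> * of_real (sin y)" for y
      by (simp add: sinh_conv_sin flip: sin_of_real mult.assoc)
    define z where "z = \<i> * complex_of_real (pi - 2 * \<epsilon>)"
    have "z / 2 = \<i> * of_real (pi / 2 - \<epsilon>)"
      by (simp add: z_def field_simps)
    then have "sinh (z / 2) = \<i> * of_real (cos \<epsilon>)"
      by (simp only: sinh_i) (simp add: sin_diff)
    moreover have "sinh z = \<i> * of_real (sin (2 * \<epsilon>))"
      unfolding z_def sinh_i by (simp add: sin_diff)
    moreover have "z \<in> D"
    proof -
      have "\<bar>cos \<epsilon>\<bar> < 1"
        using \<epsilon> cos_monotone_0_pi[of 0 \<epsilon>] cos_gt_zero[of \<epsilon>] by simp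
      then show ?thesis
        using \<epsilon> \<open>sinh (z / 2) = _\<close> by (simp add: D_def norm_mult) (simp add: z_def)
    qed
    ultimately have "q \<epsilon> = of_real (sqrt 2) * (\<i> * of_real (sin (2 * \<epsilon>))) * of_real K"
      using K(1) P_eq[of z] unfolding q_def z_def [symmetric] by (simp add: sabr_g_complex_def)
    then have "norm (q \<epsilon>) = sqrt 2 * sin (2 * \<epsilon>) * K"
      using s \<open>K \<ge> 0\<close> by (simp add: norm_mult)
    then show ?thesis
      using K s by (simp add: mult_left_mono)
  qed
  have ev: "eventually (\<lambda>\<epsilon>. 0 < \<epsilon> \<and> \<epsilon> < pi / 2) (at_right (0 :: real))"
    by (auto simp: eventually_at_right_field intro!: exI[of _ "pi / 2"])
  have "P (\<i> * pi) = 0"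
  proof (rule tendsto_unique[of "at_right (0 :: real)"])
    have "isCont P (\<i> * pi)"
      using holomorphic_on_imp_continuous_on[OF P] by (simp add: continuous_on_eq_continuous_at)
    moreover have "((\<lambda>\<epsilon>. \<i> * complex_of_real (pi - 2 * \<epsilon>)) \<longlongrightarrow> \<i> * of_real (pi - 2 * 0)) (at_right 0)"
      by (intro tendsto_intros)
    ultimately show "(q \<longlongrightarrow> P (\<i> * pi)) (at_right 0)"
      unfolding q_def by (intro isCont_tendsto_compose[of _ P]) auto
    have "((\<lambda>\<epsilon>. sqrt 2 * sin (2 * \<epsilon>) * (4 * a * cosh a * ln ((sin \<epsilon> + pi / 4) / sin \<epsilon>))) \<longlongrightarrow> 0) (at_right 0)"
      by real_asymp
    then show "(q \<longlongrightarrow> 0) (at_right 0)"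
      by (rule Lim_null_comparison[rotated]) (use ev q in \<open>auto elim!: eventually_mono\<close>)
  qed simp
  moreover have "((\<lambda>h. (P (\<i> * pi + h) - P (\<i> * pi)) / h) \<longlongrightarrow> deriv P (\<i> * pi)) (at 0)"
    unfolding DERIV_def [symmetric] by (rule holomorphic_derivI[OF P open_UNIV UNIV_I])
  \<comment> \<open>The difference quotient at i pi is taken along the increment
    \<open>- 2 * \<i> * \<epsilon>\<close>, which leads to the point used in
    \<open>q\<close>.\<close>
  moreover have "filterlim (\<lambda>\<epsilon>. - (2 * \<i> * complex_of_real \<epsilon>)) (at 0) (at_right 0)"
    by (auto simp: filterlim_at eventually_at_filter intro!: tendsto_eq_intros)
  ultimately have "((\<lambda>\<epsilon>. P (\<i> * pi + - (2 * \<i> * complex_of_real \<epsilon>)) / - (2 * \<i> * complex_of_real \<epsilon>)) \<longlongrightarrow>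
      deriv P (\<i> * pi)) (at_right 0)"
    by (auto dest: filterlim_compose)
  from tendsto_norm[OF this]
  have "((\<lambda>\<epsilon>. norm (q \<epsilon>) / \<bar>2 * \<epsilon>\<bar>) \<longlongrightarrow> norm (deriv P (\<i> * pi))) (at_right 0)"
    by (simp add: q_def norm_divide norm_mult algebra_simps abs_mult)
  \<comment> \<open>Here \<open>sin (2 * \<epsilon>) / (2 * \<epsilon>)\<close> tends to 1, and the
    remaining logarithm is unbounded.\<close>
  moreover have "filterlim (\<lambda>\<epsilon>. norm (q \<epsilon>) / \<bar>2 * \<epsilon>\<bar>) at_top (at_right 0)"
  proof (rule filterlim_at_top_mono)
    show "filterlim (\<lambda>\<epsilon>. sqrt 2 * sin (2 * \<epsilon>) * (a * ln ((sin \<epsilon> + pi / 2) / sin \<epsilon>)) / (2 * \<epsilon>)) at_top (at_right 0)"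
      using a by real_asymp
    show "eventually (\<lambda>\<epsilon>. sqrt 2 * sin (2 * \<epsilon>) * (a * ln ((sin \<epsilon> + pi / 2) / sin \<epsilon>)) / (2 * \<epsilon>) \<le>
        norm (q \<epsilon>) / \<bar>2 * \<epsilon>\<bar>) (at_right 0)"
      using ev by eventually_elim (use q in \<open>auto intro!: divide_right_mono\<close>)
  qed
  ultimately show False
    using not_tendsto_and_filterlim_at_infinity[of "at_right (0 :: real)"]
    by (meson filterlim_at_top_imp_at_infinity trivial_limit_at_right_real)
qed

section \<open>The radius of convergence\<close>

text \<open>If the terms at some t > 0 are bounded by B, then \<open>\<bar>c k\<bar>\<close> is at
  most B divided by \<open>(2 * t) ^ k * fact k\<close>, so an exponential series dominates at every
  z.\<close>

lemma conv_radius_borel_transform: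
  fixes c :: "nat \<Rightarrow> real"
  assumes "conv_radius (\<lambda>k. c k * 2 ^ k * fact k) > 0"
  shows "conv_radius (\<lambda>k. complex_of_real (c k)) = \<infinity>"
proof (rule conv_radius_inftyI'')
  fix z :: complex
  obtain t :: real where t: "0 < ereal t" "ereal t < conv_radius (\<lambda>k. c k * 2 ^ k * fact k)"
    using ereal_dense2[OF assms] by blast
  then have "summable (\<lambda>k. c k * 2 ^ k * fact k * t ^ k)"
    by (intro summable_in_conv_radius) auto
  then have "Bseq (\<lambda>k. c k * 2 ^ k * fact k * t ^ k)"
    by (rule summable_imp_Bseq)
  then obtain B where B: "\<And>k. \<bar>c k * 2 ^ k * fact k * t ^ k\<bar> \<le> B"
    unfolding Bseq_def real_norm_def by blast
  show "summable (\<lambda>k. complex_of_real (c k) * z ^ k)"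
  proof (rule summable_comparison_test'[where N = 0])
    show "summable (\<lambda>k. B * (inverse (fact k) * (norm z / (2 * t)) ^ k))"
      by (intro summable_mult summable_exp)
    fix k
    have t0: "t > 0"
      using t by simp
    have "\<bar>c k\<bar> = \<bar>c k * 2 ^ k * fact k * t ^ k\<bar> / (2 ^ k * fact k * t ^ k)"
      using t0 by (simp add: abs_mult)
    also have "\<dots> \<le> B / (2 ^ k * fact k * t ^ k)"
      using B t0 by (intro divide_right_mono) auto
    finally have "\<bar>c k\<bar> * norm z ^ k \<le> B / (2 ^ k * fact k * t ^ k) * norm z ^ k"
      by (intro mult_right_mono) auto
    also have "\<dots> = B * (inverse (fact k) * (norm z / (2 * t)) ^ k)"
      unfolding power_divide power_mult_distrib by (simp add: divide_inverse)
    finally show "norm (complex_of_real (c k) * z ^ k) \<le> B * (inverse (fact k) * (norm z / (2 * t)) ^ k)"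
      by (simp only: norm_mult norm_power norm_of_real)
  qed
qed

text \<open>A positive radius would make \<open>G\<close>, the series with coefficients
  \<open>c k\<close>, entire. Then \<open>z * eval_fps G (z\<^sup>2)\<close> would be an entire
  extension of g, which is impossible.\<close>

lemma conv_radius_watson_eq_0:
  assumes \<sigma>: "\<sigma> > 0" and r: "r > 0"
    and sums: "\<And>u. 0 < u \<Longrightarrow> u \<le> r \<Longrightarrow> (\<lambda>k. c k * u ^ (2 * k + 1)) sums sabr_g \<sigma> u"
  shows "conv_radius (\<lambda>k. c k * 2 ^ k * fact k) = 0"
proof (rule ccontr)
  assume "conv_radius (\<lambda>k. c k * 2 ^ k * fact k) \<noteq> 0"
  moreover have "conv_radius (\<lambda>k. c k * 2 ^ k * fact k) \<ge> 0"
    by (rule conv_radius_nonneg)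
  ultimately have inf: "conv_radius (\<lambda>k. complex_of_real (c k)) = \<infinity>"
    by (intro conv_radius_borel_transform) auto
  define G where "G = Abs_fps (\<lambda>k. complex_of_real (c k))"
  have G: "fps_conv_radius G = \<infinity>"
    using inf by (simp add: G_def fps_conv_radius_def)
  have "eval_fps G holomorphic_on UNIV"
    by (rule holomorphic_on_eval_fps) (simp add: G)
  then have "(\<lambda>z. eval_fps G (z\<^sup>2)) holomorphic_on UNIV"
    using holomorphic_on_compose_gen[of "\<lambda>z. z\<^sup>2" UNIV "eval_fps G" UNIV]
    by (simp add: o_def holomorphic_on_power)
  then have "(\<lambda>z. z * eval_fps G (z\<^sup>2)) holomorphic_on UNIV"
    by (intro holomorphic_on_mult holomorphic_on_ident)
  moreover have "of_real u * eval_fps G ((of_real u)\<^sup>2) = of_real (sabr_g \<sigma> u)" if u: "0 < u" "u < r" for u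
  proof -
    have "(\<lambda>k. complex_of_real (c k) * ((of_real u)\<^sup>2) ^ k) sums eval_fps G ((of_real u)\<^sup>2)"
      using sums_eval_fps[of "(complex_of_real u)\<^sup>2" G] G by (simp add: G_def)
    then have "(\<lambda>k. of_real u * (complex_of_real (c k) * ((of_real u)\<^sup>2) ^ k)) sums (of_real u * eval_fps G ((of_real u)\<^sup>2))"
      by (rule sums_mult)
    moreover have "(\<lambda>k. of_real u * (complex_of_real (c k) * ((of_real u)\<^sup>2) ^ k)) sums of_real (sabr_g \<sigma> u)"
    proof -
      have "of_real u * (complex_of_real (c k) * ((of_real u)\<^sup>2) ^ k) = of_real (c k * u ^ (2 * k + 1))" for k
        unfolding power_add power_mult power_one_right of_real_mult of_real_power by (simp only: mult_ac)
      then show ?thesis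
        using u by (simp only: sums_of_real_iff) (intro sums; simp)
    qed
    ultimately show ?thesis
      by (rule sums_unique2)
  qed
  ultimately show False
    by (rule sabr_g_no_entire_extension[OF _ r \<sigma>])
qed

text \<open>Multiplication by an exponential series cannot repair divergence: multiplying back by
  the inverse exponential, of infinite radius, would give b a positive radius as well.\<close>

lemma conv_radius_exp_mult_eq_0:
  fixes b :: "nat \<Rightarrow> real"
  assumes "conv_radius b = 0"
  shows "conv_radius (\<lambda>k. \<Sum>i\<le>k. a ^ i / fact i * b (k - i)) = 0"
proof -
  define v where "v = fps_exp a * Abs_fps b"
  have "fps_exp (- a) * v = fps_exp (- a + a) * Abs_fps b"
    unfolding v_def fps_exp_add_mult by (simp only: mult.assoc)
  then have "Abs_fps b = fps_exp (- a) * v"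
    by simp
  then have "fps_conv_radius (Abs_fps b) \<ge> min \<infinity> (fps_conv_radius v)"
    using fps_conv_radius_mult[of "fps_exp (- a)" v] by simp
  then have "fps_conv_radius v \<le> 0"
    using assms by (simp add: fps_conv_radius_def)
  then have "fps_conv_radius v = 0"
    using conv_radius_nonneg[of "fps_nth v"] by (simp add: fps_conv_radius_def)
  moreover have "fps_nth v = (\<lambda>k. \<Sum>i\<le>k. a ^ i / fact i * b (k - i))"
    by (simp add: v_def fun_eq_iff fps_mult_nth atLeast0AtMost)
  ultimately show ?thesis
    by (simp add: fps_conv_radius_def)
qed

section \<open>Assembly of the expansion of the time value\<close>

theorem mainTheorem2:
  fixes M :: "'a measure" and F :: "real \<Rightarrow> 'a measure"
    and W Z S \<sigma> :: "real \<Rightarrow> 'a \<Rightarrow> real" and S\<^sub>0 \<sigma>\<^sub>0 :: real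
  assumes model: "sabr_model M F W Z S \<sigma> S\<^sub>0 \<sigma>\<^sub>0"
    and representation:
      "\<And>T. T > 0 \<Longrightarrow> atm_time_value M S S\<^sub>0 T = sabr_atm_integral S\<^sub>0 \<sigma>\<^sub>0 T"
  shows "\<exists>v :: nat \<Rightarrow> real.
    asymp_power_series_at_right_0 (\<lambda>T. atm_time_value M S S\<^sub>0 T / sqrt T) v \<and>
    conv_radius v = 0"
proof -
  have pos: "S\<^sub>0 > 0" "\<sigma>\<^sub>0 > 0"
    using sabr_model.S\<^sub>0_pos[OF model] sabr_model.\<sigma>\<^sub>0_pos[OF model] by auto
  obtain c r where c: "r > 0" "summable (\<lambda>k. \<bar>c k\<bar> * (r\<^sup>2) ^ k)"
    "\<And>u. 0 < u \<Longrightarrow> u \<le> r \<Longrightarrow> (\<lambda>k. c k * u ^ (2 * k + 1)) sums sabr_g \<sigma>\<^sub>0 u"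
    using sabr_g_power_series[of \<sigma>\<^sub>0] by metis
  define b where "b k = c k * 2 ^ k * fact k" for k
  define C where "C = 2 * S\<^sub>0 / pi powr (3 / 2)"
  have C: "C \<noteq> 0"
    using pos by (simp add: C_def)
  let ?I = "\<lambda>T. LBINT u:{0<..}. exp (- (u\<^sup>2 / (2 * T))) * sabr_g \<sigma>\<^sub>0 u"
  have "set_borel_measurable lborel {0<..} (sabr_g \<sigma>\<^sub>0)"
    unfolding set_borel_measurable_def
    using borel_measurable_continuous_on_indicator[OF _ continuous_on_sabr_g] by simp
  moreover have "\<bar>sabr_g \<sigma>\<^sub>0 u\<bar> \<le> \<sigma>\<^sub>0 * pi * exp u" if "u > 0" for u
    using pos that by (intro abs_sabr_g_le) auto
  ultimately have "asymp_power_series_at_right_0 (\<lambda>T. ?I T / T) b"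
    unfolding b_def by (intro asymp_power_series_watson odd_power_series_global_remainder[OF c])
  \<comment> \<open>The parameter -1/8 stands for the prefactor exp (-T/8), whose expansion enters
    through the Cauchy product.\<close>
  from asymp_power_series_cmult[OF asymp_power_series_mult[OF asymp_power_series_exp this], of C "- 1 / 8"]
  have "asymp_power_series_at_right_0 (\<lambda>T. C * (exp (- 1 / 8 * T) * (?I T / T)))
      (\<lambda>k. C * (\<Sum>i\<le>k. (- 1 / 8) ^ i / fact i * b (k - i)))" .
  moreover have "atm_time_value M S S\<^sub>0 T / sqrt T = C * (exp (- 1 / 8 * T) * (?I T / T))" if "T > 0" for T
  proof -
    \<comment> \<open>The root in the representation and the one in the normalisation of V combine
      to the 1 / T in Watson's lemma.\<close>
    have "sqrt T * sqrt T = T"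
      using that by simp
    then show ?thesis
      using that by (simp add: representation sabr_atm_integral_def C_def mult.assoc)
  qed
  ultimately have "asymp_power_series_at_right_0 (\<lambda>T. atm_time_value M S S\<^sub>0 T / sqrt T)
      (\<lambda>k. C * (\<Sum>i\<le>k. (- 1 / 8) ^ i / fact i * b (k - i)))"
    by (rule asymp_power_series_cong[rotated])
  moreover have "conv_radius b = 0"
    unfolding b_def using conv_radius_watson_eq_0[OF pos(2) c(1,3)] .
  then have "conv_radius (\<lambda>k. C * (\<Sum>i\<le>k. (- 1 / 8) ^ i / fact i * b (k - i))) = 0"
    by (subst conv_radius_cmult_left[OF C]) (rule conv_radius_exp_mult_eq_0)
  ultimately show ?thesis
    by blast
qed

end
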